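(* Let $e,r\geq2$ be integers. If $r\in\{2,4\}$ or $e\in\{2,3,4,5,6\}$, then $$N_{r,e}=N'_{r,e}.$$
   Context: Set $N'_{r,e}:=\left\lfloor\frac{r^2}{2e}\left\lfloor\frac{e^2}{4}\right\rfloor\right\rfloor$. Definition of $N_{r,e}$. A partition is a finite non-increasing sequence $\lambda = (\lambda_1\geq\dots\geq\lambda_h>0)$ of positive integers (possibly empty), with Young diagram $\{(a,b): 1\le a\le h,\ 1\le b\le \lambda_a\}$. An $r$-partition is an $r$-tuple $\boldsymbol\lambda=(\lambda^{(1)},\dots,\lambda^{(r)})$ of partitions; its nodes are the triples $(a,b,j)$ with $(a,b)$ in the Young diagram of $\lambda^{(j)}$. For a multicharge $\mathsf{s}=(s_1,\dots,s_r)\in\mathbb{Z}^r$, the $\mathsf{s}$-residue of $(a,b,j)$ is $b-a+s_j \bmod e$, and $c_i^{\mathsf{s}}(\boldsymbol\lambda)$ is the number of nodes of $\mathsf{s}$-residue $i\in\mathbb{Z}/e\mathbb{Z}$. The $\mathsf{s}$-weight is $\mathsf{w}^{\mathsf{s}}(\boldsymbol\lambda):=\sum_{j=1}^r c^{\mathsf{s}}_{s_j}(\boldsymbol\lambda)-\frac12\sum_{i\in\mathbb{Z}/e\mathbb{Z}}(c^{\mathsf{s}}_i(\boldsymbol\lambda)-c^{\mathsf{s}}_{i+1}(\boldsymbol\lambda))^2$ (indices modulo $e$). $Q=\bigoplus_{i\in\mathbb{Z}/e\mathbb{Z}}\mathbb{Z}\alpha_i$ is free abelian with basis $(\alpha_i)$;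 $\delta:=\sum_i\alpha_i$; $\alpha^{\mathsf{s}}(\boldsymbol\lambda):=\sum_i c_i^{\mathsf{s}}(\boldsymbol\lambda)\alpha_i$; $Q^{\mathsf{s}}:=\{\alpha^{\mathsf{s}}(\boldsymbol\lambda):\boldsymbol\lambda\text{ an }r\text{-partition}\}$. An $r$-partition $\boldsymbol\lambda$ is an $\mathsf{s}$-reduced $e$-multicore if $\alpha^{\mathsf{s}}(\boldsymbol\lambda)-\delta\notin Q^{\mathsf{s}}$. Then $$N_{r,e}:=\sup\{\mathsf{w}^{\mathsf{s}}(\boldsymbol\lambda):\mathsf{s}\in\mathbb{Z}^r,\ \boldsymbol\lambda\text{ an }\mathsf{s}\text{-reduced }e\text{-multicore}\},$$ which is known to be finite. *)

theory Defs
  imports Complex_Main "HOL-Library.FuncSet" "HOL-Library.Extended_Real"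
begin

definition partitions :: "nat list set" where
  "partitions = {xs. sorted_wrt (\<ge>) xs \<and> (\<forall>x\<in>set xs. 0 < x)}"

definition young_diagram :: "nat list \<Rightarrow> (nat \<times> nat) set" where
  "young_diagram xs = {(a, b). 1 \<le> a \<and> a \<le> length xs \<and> 1 \<le> b \<and> b \<le> xs ! (a - 1)}"

text \<open>An \<open>r\<close>-tuple is an extensional function on \<open>{1..r}\<close>.\<close>

definition multicharges :: "nat \<Rightarrow> (nat \<Rightarrow> int) set" where
  "multicharges r = ({1..r} \<rightarrow>\<^sub>E UNIV)"

definition multipartitions :: "nat \<Rightarrow> (nat \<Rightarrow> nat list) set" where
  "multipartitions r = ({1..r} \<rightarrow>\<^sub>E partitions)"

definition nodes :: "nat \<Rightarrow> (nat \<Rightarrow> nat list) \<Rightarrow> (nat \<times> nat \<times> nat) set" where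
  "nodes r L = {(a, b, j). j \<in> {1..r} \<and> (a, b) \<in> young_diagram (L j)}"

definition residue :: "nat \<Rightarrow> (nat \<Rightarrow> int) \<Rightarrow> nat \<times> nat \<times> nat \<Rightarrow> int" where
  "residue e s = (\<lambda>(a, b, j). (int b - int a + s j) mod int e)"

text \<open>
  The index \<open>i\<close> is any integer representative of a class modulo \<open>e\<close>, so that
  \<open>res_count r e s L\<close> is \<open>e\<close>-periodic.
\<close>

definition res_count ::
    "nat \<Rightarrow> nat \<Rightarrow> (nat \<Rightarrow> int) \<Rightarrow> (nat \<Rightarrow> nat list) \<Rightarrow> int \<Rightarrow> nat" where
  "res_count r e s L i = card {n \<in> nodes r L. residue e s n = i mod int e}"

definition weight :: "nat \<Rightarrow> nat \<Rightarrow> (nat \<Rightarrow> int) \<Rightarrow> (nat \<Rightarrow> nat list) \<Rightarrow> real" where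
  "weight r e s L =
     (\<Sum>j=1..r. real (res_count r e s L (s j)))
     - 1 / 2 * (\<Sum>i\<in>{0..<int e}.
         (real (res_count r e s L i) - real (res_count r e s L (i + 1)))\<^sup>2)"

text \<open>
  An element \<open>\<Sum>i. m i \<cdot> \<alpha>\<^sub>i\<close> of the free abelian group on the classes modulo \<open>e\<close> is
  represented by its coefficients, as the \<open>e\<close>-periodic function \<open>m\<close> on the integers;
  the difference in \<open>reduced_multicores\<close> is pointwise.
\<close>

definition content ::
    "nat \<Rightarrow> nat \<Rightarrow> (nat \<Rightarrow> int) \<Rightarrow> (nat \<Rightarrow> nat list) \<Rightarrow> int \<Rightarrow> int" where
  "content r e s L = (\<lambda>i. int (res_count r e s L i))"

definition delta :: "int \<Rightarrow> int" where
  "delta = (\<lambda>_. 1)"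

definition contents :: "nat \<Rightarrow> nat \<Rightarrow> (nat \<Rightarrow> int) \<Rightarrow> (int \<Rightarrow> int) set" where
  "contents r e s = content r e s ` multipartitions r"

definition reduced_multicores ::
    "nat \<Rightarrow> nat \<Rightarrow> (nat \<Rightarrow> int) \<Rightarrow> (nat \<Rightarrow> nat list) set" where
  "reduced_multicores r e s =
     {L \<in> multipartitions r. content r e s L - delta \<notin> contents r e s}"

text \<open>
  The supremum is taken in the extended reals, so it is the true supremum without
  presupposing boundedness.
\<close>

definition max_weight :: "nat \<Rightarrow> nat \<Rightarrow> ereal" where
  "max_weight r e =
     Sup {ereal (weight r e s L) | s L. s \<in> multicharges r \<and> L \<in> reduced_multicores r e s}"

definition max_weight' :: "nat \<Rightarrow> nat \<Rightarrow> int" where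
  "max_weight' r e = \<lfloor>(real r)\<^sup>2 / (2 * real e) * of_int \<lfloor>(real e)\<^sup>2 / 4\<rfloor>\<rfloor>"

end

theory Submission
  imports Defs
begin

text \<open>
  Put every component \<open>L j\<close> on an abacus with \<open>e\<close> runners and \<open>M\<^sub>j = K * e + (s j mod e)\<close> beads,
  and let \<open>n\<^sub>j\<^sub>k\<close> be the number of its beads on runner \<open>k\<close>. The row sums of this matrix are the
  \<open>M\<^sub>j\<close>. Its column sums \<open>m\<^sub>k\<close> are determined by the differences \<open>c\<^sub>k - c\<^sub>k\<^sub>+\<^sub>1\<close> of the content, and
  subtracting \<open>\<delta>\<close> from the content lowers the total level \<open>T\<close> (the sum of \<open>x div e\<close> over all beads
  \<open>x\<close>) by one and leaves the column sums alone. Given the matrix, the possible values of \<open>T\<close> are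
  all integers from \<open>(\<Sum>\<^sub>j\<^sub>k n\<^sub>j\<^sub>k (n\<^sub>j\<^sub>k - 1)) / 2\<close> upwards. So a reduced multicore is a multipartition
  whose \<open>T\<close> is the minimum of that sum over all natural matrices with the same margins, and its
  weight is \<open>r * (T - T\<^sub>0) - (\<Sum>\<^sub>k m\<^sub>k\<^sup>2 - \<Sum>\<^sub>k v\<^sub>k\<^sup>2) / 2\<close>, where \<open>T\<^sub>0\<close> and \<open>v\<^sub>k\<close> belong to the empty
  multipartition (\<open>weight_bead_matrix\<close>, \<open>reduced_total_level_le\<close>).

  For the upper bound, which holds for all \<open>r\<close> and \<open>e\<close>, start from the real matrix of the form
  "function of the row plus function of the column" with the given margins; it has the least sum of
  squares. It can be rounded to an integer matrix \<open>y\<close> with the same margins for which \<open>\<Sum> y\<^sup>2\<close> exceeds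
  \<open>\<Sum> x\<^sup>2\<close> by at most \<open>\<Sum> {x} (1 - {x})\<close>, with \<open>{x}\<close> the fractional part
  (\<open>rounding_sum_of_squares\<close>). The matrix of the empty multipartition has at least the sum of squares
  of its own least matrix. Together this bounds the weight by
  \<open>(r / 2) * \<Sum>\<^sub>j\<^sub>k {x\<^sub>j\<^sub>k} (1 - {x\<^sub>j\<^sub>k})\<close>. Each row of \<open>x\<close> has an integral sum, so it contributes at most
  \<open>\<kappa> (e - \<kappa>) / e \<le> \<lfloor>e\<^sup>2 / 4\<rfloor> / e\<close> with \<open>\<kappa>\<close> the sum of its fractional parts. Weights are
  integers, so the bound may be replaced by its floor.

  For the lower bound take all charges equal to \<open>\<tau> = e div 2\<close> and a matrix of zeros and ones with row
  sums \<open>\<tau>\<close> and column sums as equal as possible. A matrix with entries in \<open>{K, K + 1}\<close> has the least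
  sum of squares for its margins, so the multicore is reduced. Its weight falls short of
  \<open>(r\<^sup>2 / (2 e)) * \<lfloor>e\<^sup>2 / 4\<rfloor>\<close> by \<open>f (e - f) / (2 e)\<close> with \<open>f = r \<tau> mod e\<close>. This is less than
  one in the cases considered: if \<open>e \<le> 6\<close> then \<open>f (e - f) \<le> e\<^sup>2 / 4 < 2 e\<close>, and if
  \<open>r\<close> is 2 or 4 then \<open>f\<close> is 0 or within 2 of \<open>e\<close>.
\<close>

section \<open>Rounding a matrix with integral margins\<close>

text \<open>
  View \<open>F\<close> as the edge set of a bipartite graph in which no vertex has degree one. A walk that never
  turns back and alternates between the two sides must revisit a row; the closed walk up to the first
  revisit, with alternating signs, is the required matrix.
\<close>

lemma zero_margin_direction:
  fixes F :: "('a \<times> 'b) set"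
  assumes fin: "finite J" "finite K" and F: "F \<subseteq> J \<times> K" "F \<noteq> {}"
    and row: "\<And>j k. (j, k) \<in> F \<Longrightarrow> \<exists>k'. k' \<noteq> k \<and> (j, k') \<in> F"
    and col: "\<And>j k. (j, k) \<in> F \<Longrightarrow> \<exists>j'. j' \<noteq> j \<and> (j', k) \<in> F"
  obtains z :: "'a \<Rightarrow> 'b \<Rightarrow> real" where
    "\<And>j. j \<in> J \<Longrightarrow> (\<Sum>k\<in>K. z j k) = 0" "\<And>k. k \<in> K \<Longrightarrow> (\<Sum>j\<in>J. z j k) = 0"
    "\<And>j k. z j k \<noteq> 0 \<Longrightarrow> (j, k) \<in> F" "\<exists>j k. z j k \<noteq> 0"
proof -
  have "\<exists>p. \<forall>n. p n \<in> F \<and> (fst (p (Suc n)) \<noteq> fst (p n) \<and> snd (p (Suc n)) \<noteq> snd (p n) \<and>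
      (fst (p (Suc n)), snd (p n)) \<in> F)"
  proof (rule dependent_nat_choice)
    show "\<exists>x. x \<in> F" using F by auto
    fix x :: "'a \<times> 'b" assume "x \<in> F"
    then obtain j' where j': "j' \<noteq> fst x" "(j', snd x) \<in> F" using col[of "fst x" "snd x"] by auto
    then obtain k' where "k' \<noteq> snd x" "(j', k') \<in> F" using row by blast
    then show "\<exists>y. y \<in> F \<and> fst y \<noteq> fst x \<and> snd y \<noteq> snd x \<and> (fst y, snd x) \<in> F"
      using j' by (intro exI[of _ "(j', k')"]) auto
  qed
  then obtain p where p: "\<And>n. p n \<in> F" "\<And>n. fst (p (Suc n)) \<noteq> fst (p n)"
    "\<And>n. snd (p (Suc n)) \<noteq> snd (p n)" "\<And>n. (fst (p (Suc n)), snd (p n)) \<in> F" by blast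
  define u where "u n = fst (p n)" for n
  define v where "v n = snd (p n)" for n
  have uv: "u (Suc n) \<noteq> u n" "v (Suc n) \<noteq> v n" "(u n, v n) \<in> F" "(u (Suc n), v n) \<in> F" for n
    using p by (auto simp: u_def v_def)
  have "\<not> inj u"
  proof
    assume "inj u"
    moreover have "range u \<subseteq> J" using uv(3) F(1) by blast
    ultimately show False using fin(1) by (meson finite_imageD finite_subset infinite_UNIV_nat)
  qed
  then have ex: "\<exists>b. \<exists>a<b. u a = u b"
    by (metis injI linorder_neqE_nat)
  define b where "b = (LEAST b. \<exists>a<b. u a = u b)"
  obtain a where a: "a < b" "u a = u b" using LeastI_ex[OF ex] unfolding b_def by blast
  \<comment> \<open>minimality of \<open>b\<close>: no row occurs twice before the walk closes\<close>
  have inj: "x = y" if "u x = u y" "x < b" "y < b" for x y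
    using that not_less_Least[of x "\<lambda>b. \<exists>a<b. u a = u b"] not_less_Least[of y "\<lambda>b. \<exists>a<b. u a = u b"]
    unfolding b_def[symmetric] by (metis linorder_neqE_nat)
  have ab: "Suc a < b" using a uv(1)[of a] by (metis Suc_lessI)
  define z :: "'a \<Rightarrow> 'b \<Rightarrow> real" where
    "z j k = (\<Sum>i=a..<b. of_bool (j = u i \<and> k = v i) - of_bool (j = u (Suc i) \<and> k = v i))" for j k
  have vK: "v i \<in> K" and uJ: "u i \<in> J" for i using uv(3)[of i] F(1) by auto
  have "(\<Sum>k\<in>K. z j k) = 0" for j
  proof -
    have "(\<Sum>k\<in>K. z j k) = (\<Sum>i=a..<b. \<Sum>k\<in>K. (if k = v i then of_bool (j = u i) - of_bool (j = u (Suc i)) else 0))"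
      unfolding z_def by (subst sum.swap) (intro sum.cong refl, auto)
    also have "\<dots> = (\<Sum>i=a..<b. of_bool (j = u i) - of_bool (j = u (Suc i)))"
      using vK fin(2) by simp
    also have "\<dots> = of_bool (j = u a) - of_bool (j = u b)"
      using sum_Suc_diff'[of a b "\<lambda>i. - of_bool (j = u i) :: real"] a by simp
    finally show ?thesis using a by simp
  qed
  moreover have "(\<Sum>j\<in>J. z j k) = 0" for k
  proof -
    have "(\<Sum>j\<in>J. z j k) = (\<Sum>i=a..<b. (\<Sum>j\<in>J. (if j = u i then of_bool (k = v i) else 0)) -
        (\<Sum>j\<in>J. (if j = u (Suc i) then of_bool (k = v i) else 0)))"
      unfolding z_def by (subst sum.swap) (intro sum.cong refl, auto simp: sum_subtractf[symmetric] intro!: sum.cong)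
    also have "\<dots> = 0" using uJ fin(1) by simp
    finally show ?thesis .
  qed
  moreover have "(j, k) \<in> F" if nz: "z j k \<noteq> 0" for j k
  proof -
    obtain i where "of_bool (j = u i \<and> k = v i) - of_bool (j = u (Suc i) \<and> k = v i) \<noteq> (0::real)"
      using nz unfolding z_def by (elim sum.not_neutral_contains_not_neutral)
    then have "(j = u i \<and> k = v i) \<or> (j = u (Suc i) \<and> k = v i)"
      unfolding of_bool_def by argo
    then show ?thesis using uv(3,4)[of i] by blast
  qed
  \<comment> \<open>This entry is visited with a positive sign, and no step with a negative sign can cancel it: the
      only such step in its row is the one into \<open>u (Suc a)\<close>, which uses the other column \<open>v a\<close>.\<close>
  moreover have "z (u (Suc a)) (v (Suc a)) > 0"
    unfolding z_def
  proof (rule sum_pos2[of _ "Suc a"])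
    have "u (Suc a) \<noteq> u (Suc i) \<or> v (Suc a) \<noteq> v i" if "a \<le> i" "i < b" for i
    proof (cases "Suc i = b")
      case True
      then have "u (Suc i) = u a" using a by simp
      then show ?thesis using uv(1)[of a] by auto
    next
      case False
      then show ?thesis using inj[of "Suc a" "Suc i"] uv(2)[of a] ab that by auto
    qed
    then show "0 \<le> of_bool (u (Suc a) = u i \<and> v (Suc a) = v i) -
        (of_bool (u (Suc a) = u (Suc i) \<and> v (Suc a) = v i) :: real)"
      if "i \<in> {a..<b}" for i using that by auto
  next
    show "0 < of_bool (u (Suc a) = u (Suc a) \<and> v (Suc a) = v (Suc a)) -
        (of_bool (u (Suc a) = u (Suc (Suc a)) \<and> v (Suc a) = v (Suc a)) :: real)"
      using uv(1)[of "Suc a"] by auto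
  qed (use ab in auto)
  ultimately show thesis using that[of z] by (metis less_irrefl)
qed

lemma not_Ints_another:
  fixes f :: "'a \<Rightarrow> real"
  assumes "finite A" "(\<Sum>a\<in>A. f a) \<in> \<int>" "a \<in> A" "f a \<notin> \<int>"
  shows "\<exists>b. b \<noteq> a \<and> b \<in> A \<and> f b \<notin> \<int>"
proof (rule ccontr)
  assume "\<not> ?thesis"
  then have "(\<Sum>b\<in>A - {a}. f b) \<in> \<int>" by (intro Ints_sum) auto
  moreover have "f a = (\<Sum>a\<in>A. f a) - (\<Sum>b\<in>A - {a}. f b)"
    using assms by (simp add: sum.remove)
  ultimately show False using assms by (metis Ints_diff)
qed

text \<open>
  Integrality of transportation polytopes. As long as \<open>x\<close> has a fractional entry, every row and
  column meeting one meets a second, so \<open>x\<close> can be moved along a direction of zero margins, with the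
  sign that does not increase the cost, until another entry becomes integral. No entry leaves the
  interval between its floor and its ceiling, and integral entries stay fixed.
\<close>

lemma integral_rounding:
  fixes x c :: "'a \<Rightarrow> 'b \<Rightarrow> real"
  assumes fin: "finite J" "finite K"
    and "\<And>j. j \<in> J \<Longrightarrow> (\<Sum>k\<in>K. x j k) \<in> \<int>" "\<And>k. k \<in> K \<Longrightarrow> (\<Sum>j\<in>J. x j k) \<in> \<int>"
  shows "\<exists>y :: 'a \<Rightarrow> 'b \<Rightarrow> int.
    (\<forall>j\<in>J. \<forall>k\<in>K. \<lfloor>x j k\<rfloor> \<le> y j k \<and> y j k \<le> \<lceil>x j k\<rceil>) \<and>
    (\<forall>j\<in>J. (\<Sum>k\<in>K. of_int (y j k)) = (\<Sum>k\<in>K. x j k)) \<and>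
    (\<forall>k\<in>K. (\<Sum>j\<in>J. of_int (y j k)) = (\<Sum>j\<in>J. x j k)) \<and>
    (\<Sum>j\<in>J. \<Sum>k\<in>K. c j k * of_int (y j k)) \<le> (\<Sum>j\<in>J. \<Sum>k\<in>K. c j k * x j k)"
  using assms(3,4)
proof (induction "card {(j, k) \<in> J \<times> K. x j k \<notin> \<int>}" arbitrary: x rule: less_induct)
  case less
  define F where "F = {(j, k) \<in> J \<times> K. x j k \<notin> \<int>}"
  have FJK: "F \<subseteq> J \<times> K" and finF: "finite F"
    using fin finite_subset[of F "J \<times> K"] by (auto simp: F_def)
  show ?case
  proof (cases "F = {}")
    case True
    then have fl: "of_int \<lfloor>x j k\<rfloor> = x j k" if "j \<in> J" "k \<in> K" for j k
      using that Ints_cases[of "x j k"] by (auto simp: F_def)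
    show ?thesis
      by (intro exI[of _ "\<lambda>j k. \<lfloor>x j k\<rfloor>"])
        (simp add: fl floor_le_ceiling del: of_int_floor_cancel)
  next
    case False
    have row: "\<exists>k'. k' \<noteq> k \<and> (j, k') \<in> F" if "(j, k) \<in> F" for j k
      using that not_Ints_another[of K "x j" k] less.prems(1)[of j] fin by (auto simp: F_def)
    have col: "\<exists>j'. j' \<noteq> j \<and> (j', k) \<in> F" if "(j, k) \<in> F" for j k
      using that not_Ints_another[of J "\<lambda>j. x j k" j] less.prems(2)[of k] fin by (auto simp: F_def)
    obtain z0 :: "'a \<Rightarrow> 'b \<Rightarrow> real" where z0:
      "\<And>j. j \<in> J \<Longrightarrow> (\<Sum>k\<in>K. z0 j k) = 0" "\<And>k. k \<in> K \<Longrightarrow> (\<Sum>j\<in>J. z0 j k) = 0"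
      "\<And>j k. z0 j k \<noteq> 0 \<Longrightarrow> (j, k) \<in> F" "\<exists>j k. z0 j k \<noteq> 0"
      using zero_margin_direction[OF fin FJK False row col] by blast
    define \<sigma> :: real where "\<sigma> = (if (\<Sum>j\<in>J. \<Sum>k\<in>K. c j k * z0 j k) \<le> 0 then 1 else -1)"
    define z where "z j k = \<sigma> * z0 j k" for j k
    have "\<sigma> \<noteq> 0" by (simp add: \<sigma>_def)
    then have z: "\<And>j. j \<in> J \<Longrightarrow> (\<Sum>k\<in>K. z j k) = 0" "\<And>k. k \<in> K \<Longrightarrow> (\<Sum>j\<in>J. z j k) = 0"
      "\<And>j k. z j k \<noteq> 0 \<Longrightarrow> (j, k) \<in> F" "\<exists>j k. z j k \<noteq> 0"
      using z0 by (auto simp: z_def sum_distrib_left[symmetric])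
    have "(\<Sum>j\<in>J. \<Sum>k\<in>K. c j k * z j k) = \<sigma> * (\<Sum>j\<in>J. \<Sum>k\<in>K. c j k * z0 j k)"
      by (simp add: z_def sum_distrib_left mult.left_commute)
    then have cz: "(\<Sum>j\<in>J. \<Sum>k\<in>K. c j k * z j k) \<le> 0" by (simp add: \<sigma>_def)
    define G where "G = {(j, k) \<in> F. z j k \<noteq> 0}"
    have "G \<subseteq> F" by (auto simp: G_def)
    then have "finite G" using finF finite_subset by blast
    moreover have "G \<noteq> {}" using z(3,4) unfolding G_def by blast
    ultimately have G: "finite G" "G \<noteq> {}" by auto
    \<comment> \<open>the step length at which entry \<open>(j, k)\<close> becomes integral; the least of them is taken\<close>
    define t where "t = (\<lambda>(j, k). ((if z j k > 0 then \<lceil>x j k\<rceil> else \<lfloor>x j k\<rfloor>) - x j k) / z j k)"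
    define \<epsilon> where "\<epsilon> = Min (t ` G)"
    have "\<epsilon> \<in> t ` G" using G by (simp add: \<epsilon>_def)
    then obtain j0 k0 where jk0: "(j0, k0) \<in> G" "\<epsilon> = t (j0, k0)" by auto
    have tpos: "t (j, k) > 0" if "(j, k) \<in> G" for j k
    proof -
      have "x j k \<notin> \<int>" "z j k \<noteq> 0" using that by (auto simp: G_def F_def)
      then have "\<lfloor>x j k\<rfloor> < x j k" "x j k < \<lceil>x j k\<rceil>"
        by (metis Ints_of_int of_int_floor_le order_le_less)
          (metis Ints_of_int \<open>x j k \<notin> \<int>\<close> le_of_int_ceiling order_le_less)
      then show ?thesis using \<open>z j k \<noteq> 0\<close>
        by (cases "z j k > 0") (auto simp: t_def divide_pos_pos divide_neg_neg)
    qed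
    have eps0: "\<epsilon> > 0" using jk0 tpos by simp
    define x' where "x' j k = x j k + \<epsilon> * z j k" for j k
    have between: "of_int \<lfloor>x j k\<rfloor> \<le> x' j k \<and> x' j k \<le> of_int \<lceil>x j k\<rceil>" for j k
    proof (cases "z j k = 0")
      case True
      then show ?thesis by (simp add: x'_def)
    next
      case False
      then have "(j, k) \<in> G" using z(3) by (auto simp: G_def)
      then have le: "\<epsilon> \<le> t (j, k)" using G by (simp add: \<epsilon>_def)
      show ?thesis
      proof (cases "z j k > 0")
        case True
        then have "\<epsilon> * z j k \<le> \<lceil>x j k\<rceil> - x j k" using le by (simp add: t_def field_simps)
        moreover have "\<epsilon> * z j k \<ge> 0" using True eps0 by simp
        ultimately show ?thesis by (simp add: x'_def) linarith
      next
        case neg: False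
        then have "\<epsilon> * z j k \<ge> \<lfloor>x j k\<rfloor> - x j k" using le False by (simp add: t_def field_simps)
        moreover have "\<epsilon> * z j k \<le> 0" using neg eps0 by (simp add: mult_nonneg_nonpos)
        ultimately show ?thesis by (simp add: x'_def) linarith
      qed
    qed
    have "{(j, k) \<in> J \<times> K. x' j k \<notin> \<int>} \<subset> F"
    proof
      show "{(j, k) \<in> J \<times> K. x' j k \<notin> \<int>} \<subseteq> F"
        using z(3) by (force simp: F_def x'_def)
      have "z j0 k0 \<noteq> 0" using jk0 by (auto simp: G_def)
      then have "x' j0 k0 \<in> \<int>" using jk0 by (simp add: x'_def t_def)
      then show "{(j, k) \<in> J \<times> K. x' j k \<notin> \<int>} \<noteq> F" using jk0 by (auto simp: G_def)
    qed
    then have card: "card {(j, k) \<in> J \<times> K. x' j k \<notin> \<int>} < card F"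
      by (rule psubset_card_mono[OF finF])
    have sums: "(\<Sum>k\<in>K. x' j k) = (\<Sum>k\<in>K. x j k)" if "j \<in> J" for j
      using z(1)[OF that] by (simp add: x'_def sum.distrib sum_distrib_left[symmetric])
    have sums': "(\<Sum>j\<in>J. x' j k) = (\<Sum>j\<in>J. x j k)" if "k \<in> K" for k
      using z(2)[OF that] by (simp add: x'_def sum.distrib sum_distrib_left[symmetric])
    have "(\<Sum>k\<in>K. x' j k) \<in> \<int>" if "j \<in> J" for j
      using sums[OF that] less.prems(1)[OF that] by simp
    moreover have "(\<Sum>j\<in>J. x' j k) \<in> \<int>" if "k \<in> K" for k
      using sums'[OF that] less.prems(2)[OF that] by simp
    ultimately obtain y :: "'a \<Rightarrow> 'b \<Rightarrow> int" where y:
      "\<And>j k. j \<in> J \<Longrightarrow> k \<in> K \<Longrightarrow> \<lfloor>x' j k\<rfloor> \<le> y j k \<and> y j k \<le> \<lceil>x' j k\<rceil>"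
      "\<And>j. j \<in> J \<Longrightarrow> (\<Sum>k\<in>K. of_int (y j k)) = (\<Sum>k\<in>K. x' j k)"
      "\<And>k. k \<in> K \<Longrightarrow> (\<Sum>j\<in>J. of_int (y j k)) = (\<Sum>j\<in>J. x' j k)"
      "(\<Sum>j\<in>J. \<Sum>k\<in>K. c j k * of_int (y j k)) \<le> (\<Sum>j\<in>J. \<Sum>k\<in>K. c j k * x' j k)"
      using less.hyps[OF card[unfolded F_def]] by blast
    have "(\<Sum>j\<in>J. \<Sum>k\<in>K. c j k * x' j k) =
        (\<Sum>j\<in>J. \<Sum>k\<in>K. c j k * x j k) + \<epsilon> * (\<Sum>j\<in>J. \<Sum>k\<in>K. c j k * z j k)"
      by (simp add: x'_def sum.distrib sum_distrib_left algebra_simps)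
    also have "\<dots> \<le> (\<Sum>j\<in>J. \<Sum>k\<in>K. c j k * x j k)"
      using cz eps0 by (simp add: mult_nonneg_nonpos)
    finally have "(\<Sum>j\<in>J. \<Sum>k\<in>K. c j k * x' j k) \<le> (\<Sum>j\<in>J. \<Sum>k\<in>K. c j k * x j k)" .
    moreover have "\<lfloor>x j k\<rfloor> \<le> y j k \<and> y j k \<le> \<lceil>x j k\<rceil>" if "j \<in> J" "k \<in> K" for j k
    proof -
      have "\<lfloor>x j k\<rfloor> \<le> \<lfloor>x' j k\<rfloor>" "\<lceil>x' j k\<rceil> \<le> \<lceil>x j k\<rceil>"
        using between[of j k] by (simp_all add: le_floor_iff ceiling_le_iff)
      then show ?thesis using y(1)[OF that] by linarith
    qed
    ultimately show ?thesis using y(2-4) sums sums' by (intro exI[of _ y]) auto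
  qed
qed

text \<open>
  The piecewise linear interpolation of \<open>n \<mapsto> n\<^sup>2\<close> between integers exceeds \<open>x\<^sup>2\<close> by this
  amount, which is also the variance of an unbiased random rounding of \<open>x\<close>.
\<close>

definition rounding_excess :: "real \<Rightarrow> real" where
  "rounding_excess x = frac x * (1 - frac x)"

text \<open>
  Between the floor and the ceiling of \<open>x j k\<close> the interpolation of the square is affine, so the
  interpolated sum of squares is a linear cost to which the rounding theorem applies; on the integral
  result it is the sum of squares itself.
\<close>

lemma rounding_sum_of_squares:
  fixes x :: "'a \<Rightarrow> 'b \<Rightarrow> real"
  assumes fin: "finite J" "finite K"
    and "\<And>j. j \<in> J \<Longrightarrow> (\<Sum>k\<in>K. x j k) \<in> \<int>" "\<And>k. k \<in> K \<Longrightarrow> (\<Sum>j\<in>J. x j k) \<in> \<int>"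
  obtains y :: "'a \<Rightarrow> 'b \<Rightarrow> int" where
    "\<And>j k. j \<in> J \<Longrightarrow> k \<in> K \<Longrightarrow> \<lfloor>x j k\<rfloor> \<le> y j k"
    "\<And>j. j \<in> J \<Longrightarrow> (\<Sum>k\<in>K. of_int (y j k)) = (\<Sum>k\<in>K. x j k)"
    "\<And>k. k \<in> K \<Longrightarrow> (\<Sum>j\<in>J. of_int (y j k)) = (\<Sum>j\<in>J. x j k)"
    "(\<Sum>j\<in>J. \<Sum>k\<in>K. (of_int (y j k))\<^sup>2) \<le> (\<Sum>j\<in>J. \<Sum>k\<in>K. (x j k)\<^sup>2 + rounding_excess (x j k))"
proof -
  define c where "c j k = 2 * of_int \<lfloor>x j k\<rfloor> + (1::real)" for j k
  define d where "d j k = of_int \<lfloor>x j k\<rfloor> * (of_int \<lfloor>x j k\<rfloor> + (1::real))" for j k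
  obtain y :: "'a \<Rightarrow> 'b \<Rightarrow> int" where y:
    "\<And>j k. j \<in> J \<Longrightarrow> k \<in> K \<Longrightarrow> \<lfloor>x j k\<rfloor> \<le> y j k \<and> y j k \<le> \<lceil>x j k\<rceil>"
    "\<And>j. j \<in> J \<Longrightarrow> (\<Sum>k\<in>K. of_int (y j k)) = (\<Sum>k\<in>K. x j k)"
    "\<And>k. k \<in> K \<Longrightarrow> (\<Sum>j\<in>J. of_int (y j k)) = (\<Sum>j\<in>J. x j k)"
    "(\<Sum>j\<in>J. \<Sum>k\<in>K. c j k * of_int (y j k)) \<le> (\<Sum>j\<in>J. \<Sum>k\<in>K. c j k * x j k)"
    using integral_rounding[OF assms, of c] by blast
  have "(of_int (y j k))\<^sup>2 = c j k * of_int (y j k) - d j k" if "j \<in> J" "k \<in> K" for j k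
  proof -
    have "y j k = \<lfloor>x j k\<rfloor> \<or> y j k = \<lfloor>x j k\<rfloor> + 1" 
      using y(1)[OF that] ceiling_diff_floor_le_1[of "x j k"] by linarith
    then show ?thesis by (auto simp: c_def d_def power2_eq_square algebra_simps)
  qed
  then have "(\<Sum>j\<in>J. \<Sum>k\<in>K. (of_int (y j k))\<^sup>2) = (\<Sum>j\<in>J. \<Sum>k\<in>K. c j k * of_int (y j k) - d j k)"
    by simp
  also have "\<dots> \<le> (\<Sum>j\<in>J. \<Sum>k\<in>K. c j k * x j k - d j k)"
    using y(4) by (simp add: sum_subtractf)
  also have "\<dots> = (\<Sum>j\<in>J. \<Sum>k\<in>K. (x j k)\<^sup>2 + rounding_excess (x j k))"
    by (intro sum.cong refl)
      (simp add: c_def d_def rounding_excess_def frac_def power2_eq_square algebra_simps)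
  finally show thesis using that y by blast
qed

text \<open>
  The fractional parts have an integral sum \<open>\<kappa>\<close>, so by Cauchy-Schwarz their squares sum to at
  least \<open>\<kappa>\<^sup>2 / e\<close>, and \<open>\<kappa> (e - \<kappa>) \<le> e\<^sup>2 / 4\<close>.
\<close>

lemma sum_rounding_excess_le:
  fixes x :: "nat \<Rightarrow> real"
  assumes e: "e > 0" and int: "(\<Sum>k<e. x k) \<in> \<int>"
  shows "(\<Sum>k<e. rounding_excess (x k)) \<le> of_int \<lfloor>(real e)\<^sup>2 / 4\<rfloor> / real e"
proof -
  have "(\<Sum>k<e. frac (x k)) = (\<Sum>k<e. x k) - of_int (\<Sum>k<e. \<lfloor>x k\<rfloor>)"
    by (simp add: frac_def sum_subtractf)
  then have "(\<Sum>k<e. frac (x k)) \<in> \<int>" using int by (metis Ints_diff Ints_of_int)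
  then obtain \<kappa> :: int where \<kappa>: "(\<Sum>k<e. frac (x k)) = of_int \<kappa>" by (elim Ints_cases)
  have "0 \<le> (\<Sum>k<e. (frac (x k) - \<kappa> / e)\<^sup>2)" by (intro sum_nonneg) simp
  also have "\<dots> = (\<Sum>k<e. (frac (x k))\<^sup>2 - 2 * (\<kappa> / e) * frac (x k) + (\<kappa> / e)\<^sup>2)"
    by (intro sum.cong) (auto simp: power2_eq_square algebra_simps)
  also have "\<dots> = (\<Sum>k<e. (frac (x k))\<^sup>2) - \<kappa>\<^sup>2 / e"
    using e by (simp only: sum.distrib sum_subtractf sum_distrib_left[symmetric] \<kappa>)
      (simp add: power2_eq_square)
  finally have sq: "\<kappa>\<^sup>2 / e \<le> (\<Sum>k<e. (frac (x k))\<^sup>2)" by simp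
  have "(\<Sum>k<e. rounding_excess (x k)) = \<kappa> - (\<Sum>k<e. (frac (x k))\<^sup>2)"
    by (simp add: rounding_excess_def algebra_simps sum_subtractf \<kappa> power2_eq_square)
  also have "\<dots> \<le> \<kappa> - \<kappa>\<^sup>2 / e" using sq by simp
  also have "\<dots> = of_int (\<kappa> * (int e - \<kappa>)) / e" using e by (simp add: field_simps power2_eq_square)
  finally have "(\<Sum>k<e. rounding_excess (x k)) \<le> of_int (\<kappa> * (int e - \<kappa>)) / e" .
  moreover have "\<kappa> * (int e - \<kappa>) \<le> \<lfloor>(real e)\<^sup>2 / 4\<rfloor>"
  proof -
    have "0 \<le> (real e - 2 * \<kappa>)\<^sup>2" by simp
    then have "\<kappa> * (real e - \<kappa>) \<le> (real e)\<^sup>2 / 4" by (simp add: power2_eq_square algebra_simps)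
    then show ?thesis by (simp add: le_floor_iff)
  qed
  ultimately show ?thesis using e by (smt (verit) divide_right_mono of_int_le_iff of_nat_0_le_iff)
qed

text \<open>
  The orthogonal decomposition of two-way analysis of variance: the additive matrix with the margins of
  \<open>n\<close> is the orthogonal projection of \<open>n\<close> onto the matrices of the form "function of the row plus
  function of the column". It is used as an equality for the additive matrix itself and as an
  inequality for the matrix of the empty multipartition.
\<close>

lemma interaction_identity:
  fixes n :: "'a \<Rightarrow> 'b \<Rightarrow> real" and m :: "'b \<Rightarrow> real" and M :: "'a \<Rightarrow> real"
  assumes "finite J" "finite K" "J \<noteq> {}" "K \<noteq> {}"
    and row: "\<And>j. j \<in> J \<Longrightarrow> (\<Sum>k\<in>K. n j k) = M j" and col: "\<And>k. k \<in> K \<Longrightarrow> (\<Sum>j\<in>J. n j k) = m k"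
  shows "(\<Sum>j\<in>J. \<Sum>k\<in>K. (n j k - (m k / card J + M j / card K - (\<Sum>j\<in>J. M j) / (card J * card K)))\<^sup>2) =
    (\<Sum>j\<in>J. \<Sum>k\<in>K. (n j k)\<^sup>2) - ((\<Sum>k\<in>K. (m k)\<^sup>2) / card J + (\<Sum>j\<in>J. (M j)\<^sup>2) / card K
      - (\<Sum>j\<in>J. M j)\<^sup>2 / (card J * card K))"
proof -
  define r where "r = real (card J)"
  define e where "e = real (card K)"
  define S where "S = (\<Sum>j\<in>J. M j)"
  have re: "r \<noteq> 0" "e \<noteq> 0" using assms by (auto simp: r_def e_def)
  have S': "(\<Sum>k\<in>K. m k) = S"
    unfolding S_def using row col sum.swap[of n K J] by simp
  have nm: "(\<Sum>j\<in>J. \<Sum>k\<in>K. n j k * m k) = (\<Sum>k\<in>K. (m k)\<^sup>2)"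
    by (subst sum.swap) (simp add: sum_distrib_right[symmetric] col power2_eq_square)
  have nM: "(\<Sum>j\<in>J. \<Sum>k\<in>K. n j k * M j) = (\<Sum>j\<in>J. (M j)\<^sup>2)"
    by (simp add: sum_distrib_right[symmetric] row power2_eq_square)
  have n1: "(\<Sum>j\<in>J. \<Sum>k\<in>K. n j k) = S" using row by (simp add: S_def)
  have mM: "(\<Sum>j\<in>J. \<Sum>k\<in>K. m k * M j) = S * S"
    by (simp add: sum_distrib_right[symmetric] sum_distrib_left[symmetric] S' S_def[symmetric])
  have "(\<Sum>j\<in>J. \<Sum>k\<in>K. (n j k - (m k / r + M j / e - S / (r * e)))\<^sup>2) =
    (\<Sum>j\<in>J. \<Sum>k\<in>K. (n j k)\<^sup>2 + (m k)\<^sup>2 / r\<^sup>2 + (M j)\<^sup>2 / e\<^sup>2 + S\<^sup>2 / (r * e)\<^sup>2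
      - 2 / r * (n j k * m k) - 2 / e * (n j k * M j) + 2 * S / (r * e) * n j k
      + 2 / (r * e) * (m k * M j) - 2 * S / (r\<^sup>2 * e) * m k - 2 * S / (r * e\<^sup>2) * M j)"
    using re by (intro sum.cong refl) (simp add: power2_eq_square field_simps)
  also have "\<dots> = (\<Sum>j\<in>J. \<Sum>k\<in>K. (n j k)\<^sup>2) + r * (\<Sum>k\<in>K. (m k)\<^sup>2) / r\<^sup>2 + e * (\<Sum>j\<in>J. (M j)\<^sup>2) / e\<^sup>2
      + r * e * S\<^sup>2 / (r * e)\<^sup>2 - 2 / r * (\<Sum>k\<in>K. (m k)\<^sup>2) - 2 / e * (\<Sum>j\<in>J. (M j)\<^sup>2) + 2 * S / (r * e) * S
      + 2 / (r * e) * (S * S) - 2 * S / (r\<^sup>2 * e) * (r * S) - 2 * S / (r * e\<^sup>2) * (e * S)"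
    by (simp add: sum.distrib sum_subtractf sum_distrib_left[symmetric] sum_divide_distrib[symmetric]
       nm nM n1 mM S' S_def[symmetric] r_def[symmetric] e_def[symmetric]) (simp add: mult_ac)
  also have "\<dots> = (\<Sum>j\<in>J. \<Sum>k\<in>K. (n j k)\<^sup>2) - ((\<Sum>k\<in>K. (m k)\<^sup>2) / r + (\<Sum>j\<in>J. (M j)\<^sup>2) / e - S\<^sup>2 / (r * e))"
    using re by (simp add: power2_eq_square field_simps)
  finally show ?thesis by (simp add: r_def e_def S_def)
qed

section \<open>Partitions as bead sets\<close>

text \<open>
  Rows are indexed from 0 here, and rows beyond the length are empty, so that a partition can be
  displayed with any number \<open>M\<close> of beads that is at least its length.
\<close>

definition part :: "nat list \<Rightarrow> nat \<Rightarrow> nat" where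
  "part p a = (if a < length p then p ! a else 0)"

definition beads :: "nat \<Rightarrow> nat list \<Rightarrow> nat set" where
  "beads M p = (\<lambda>a. part p a + (M - 1 - a)) ` {..<M}"

lemma part_antimono:
  assumes "p \<in> partitions" "a \<le> b"
  shows "part p b \<le> part p a"
proof (cases "a = b \<or> length p \<le> b")
  case True
  then show ?thesis by (auto simp: part_def)
next
  case False
  then show ?thesis
    using assms sorted_wrt_nth_less[of "(\<ge>)" p a b] by (auto simp: part_def partitions_def)
qed

lemma inj_on_beads:
  assumes "p \<in> partitions"
  shows "inj_on (\<lambda>a. part p a + (M - 1 - a)) {..<M}"
proof -
  have "part p b + (M - 1 - b) < part p a + (M - 1 - a)" if "a < b" "b < M" for a b
    using part_antimono[OF assms, of a b] that by simp
  then show ?thesis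
    by (intro linorder_inj_onI) (auto simp: less_imp_neq[THEN not_sym])
qed

lemma card_beads: "p \<in> partitions \<Longrightarrow> card (beads M p) = M"
  unfolding beads_def by (subst card_image[OF inj_on_beads]) auto

lemma finite_beads: "finite (beads M p)"
  by (simp add: beads_def)

definition comp_count :: "nat \<Rightarrow> int \<Rightarrow> nat list \<Rightarrow> int \<Rightarrow> nat" where
  "comp_count e s p i = card {(a, b) \<in> young_diagram p. (int b - int a + s) mod int e = i mod int e}"

lemma finite_young: "finite (young_diagram p)"
proof -
  have "young_diagram p \<subseteq> {..length p} \<times> {..Max (set p)}"
    by (fastforce simp: young_diagram_def intro: order_trans[OF _ Max_ge])
  then show ?thesis using finite_subset by blast
qed

lemma res_count_sum: "res_count r e s L i = (\<Sum>j=1..r. comp_count e (s j) (L j) i)"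
proof -
  define A where "A j = {(a, b) \<in> young_diagram (L j). (int b - int a + s j) mod int e = i mod int e}" for j
  have fin: "finite (A j)" for j
    using finite_subset[OF _ finite_young[of "L j"], of "A j"] by (auto simp: A_def)
  have "{n \<in> nodes r L. residue e s n = i mod int e} = (\<lambda>(j, a, b). (a, b, j)) ` (SIGMA j:{1..r}. A j)"
    by (force simp: nodes_def residue_def A_def)
  then have "res_count r e s L i = card (SIGMA j:{1..r}. A j)"
    by (simp add: res_count_def card_image inj_on_def split: prod.splits)
  also have "\<dots> = (\<Sum>j=1..r. card (A j))" using fin by simp
  finally show ?thesis by (simp add: comp_count_def A_def)
qed

text \<open>
  \<open>(x - i) div e\<close> is a counting function of the residue class of \<open>i\<close>: it jumps by one exactly at the
  elements of the class.
\<close>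

lemma card_congruent_in_interval:
  assumes "e > 0"
  shows "int (card {b \<in> {1..n}. (u + int b) mod int e = i mod int e}) = (u + int n - i) div int e - (u - i) div int e"
proof (induction n)
  case 0
  then show ?case by simp
next
  case (Suc n)
  let ?y = "u + int (Suc n)"
  have *: "(?y - i) div int e - (?y - 1 - i) div int e = of_bool (?y mod int e = i mod int e)"
  proof (cases "?y mod int e = i mod int e")
    case True
    then have "int e dvd ?y - i" by (simp add: mod_eq_dvd_iff)
    then obtain q where q: "?y - i = int e * q" by blast
    have "(?y - 1 - i) div int e = q - 1"
      using q assms by (intro int_div_pos_eq[of _ _ _ "int e - 1"]) (simp_all add: algebra_simps)
    then show ?thesis using True q assms by simp
  next
    case False
    then have "(?y - i) mod int e \<noteq> 0" by (simp add: mod_eq_dvd_iff dvd_eq_mod_eq_0)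
    then have "1 \<le> (?y - i) mod int e" "(?y - i) mod int e < int e"
      using assms pos_mod_sign[of "int e" "?y - i"] pos_mod_bound[of "int e" "?y - i"] by linarith+
    then have "(?y - 1 - i) div int e = (?y - i) div int e"
      using mult_div_mod_eq[of "int e" "?y - i"]
      by (intro int_div_pos_eq[of _ _ _ "(?y - i) mod int e - 1"]) linarith+
    then show ?thesis using False by simp
  qed
  have "{b \<in> {1..Suc n}. (u + int b) mod int e = i mod int e} =
    {b \<in> {1..n}. (u + int b) mod int e = i mod int e} \<union> (if ?y mod int e = i mod int e then {Suc n} else {})"
    by (auto simp: le_Suc_eq)
  then have "int (card {b \<in> {1..Suc n}. (u + int b) mod int e = i mod int e}) =
    int (card {b \<in> {1..n}. (u + int b) mod int e = i mod int e}) + of_bool (?y mod int e = i mod int e)"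
    by auto
  moreover have "?y - 1 - i = u + int n - i" by simp
  ultimately show ?case using Suc.IH * by simp
qed

text \<open>
  When \<open>M \<equiv> s\<close> modulo \<open>e\<close>, the residues in row \<open>a\<close> are those of the integers after \<open>M - 1 - a\<close>
  (the bead of an empty row) up to the bead of row \<open>a\<close>. Each row thus contributes a difference of
  values of one counting function, and the sum depends only on the set of beads.
\<close>

lemma comp_count_beads:
  assumes e: "e > 0" and p: "p \<in> partitions" "length p \<le> M" and s: "int M mod int e = s mod int e"
  shows "int (comp_count e s p i) = (\<Sum>x\<in>beads M p. (int x - i) div int e) - (\<Sum>x<M. (int x - i) div int e)"
proof -
  define A where "A a = {b \<in> {1..part p a}. (int (M - 1 - a) + int b) mod int e = i mod int e}" for a
  have eq: "(int b - int (Suc a) + s) mod int e = (int (M - 1 - a) + int b) mod int e" if "a < M" for a b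
  proof -
    have "(int b - int (Suc a) + s) mod int e = (int b - int (Suc a) + int M) mod int e"
      using s by (metis mod_add_right_eq)
    also have "int b - int (Suc a) + int M = int (M - 1 - a) + int b" using that by simp
    finally show ?thesis .
  qed
  have "{(a, b) \<in> young_diagram p. (int b - int a + s) mod int e = i mod int e} =
      (\<lambda>(a, b). (Suc a, b)) ` (SIGMA a:{..<M}. A a)"
  proof (intro set_eqI iffI)
    fix x assume "x \<in> {(a, b) \<in> young_diagram p. (int b - int a + s) mod int e = i mod int e}"
    then obtain a b where x: "x = (Suc a, b)" "a < length p" "1 \<le> b" "b \<le> p ! a"
      "(int b - int (Suc a) + s) mod int e = i mod int e"
      by (cases x; cases "fst x") (auto simp: young_diagram_def)
    then show "x \<in> (\<lambda>(a, b). (Suc a, b)) ` (SIGMA a:{..<M}. A a)"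
      using p(2) eq[of a b] by (intro image_eqI[of _ _ "(a, b)"]) (auto simp: A_def part_def)
  next
    fix x assume "x \<in> (\<lambda>(a, b). (Suc a, b)) ` (SIGMA a:{..<M}. A a)"
    then obtain a b where x: "x = (Suc a, b)" "a < M" "1 \<le> b" "b \<le> part p a"
      "(int (M - 1 - a) + int b) mod int e = i mod int e"
      by (auto simp: A_def)
    then show "x \<in> {(a, b) \<in> young_diagram p. (int b - int a + s) mod int e = i mod int e}"
      using eq[of a b] by (auto simp: young_diagram_def part_def split: if_splits)
  qed
  then have "comp_count e s p i = card (SIGMA a:{..<M}. A a)"
    by (simp add: comp_count_def card_image inj_on_def split: prod.splits)
  also have "\<dots> = (\<Sum>a<M. card (A a))" by (simp add: A_def)
  finally have "int (comp_count e s p i) = (\<Sum>a<M. (int (M - 1 - a) + int (part p a) - i) div int e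
      - (int (M - 1 - a) - i) div int e)"
    unfolding A_def using card_congruent_in_interval[OF e] by simp
  also have "\<dots> = (\<Sum>a<M. (int (part p a + (M - 1 - a)) - i) div int e) - (\<Sum>a<M. (int (M - 1 - a) - i) div int e)"
    by (simp only: sum_subtractf add.commute of_nat_add)
  also have "(\<Sum>a<M. (int (M - 1 - a) - i) div int e) = (\<Sum>x<M. (int x - i) div int e)"
    by (subst sum.nat_diff_reindex[symmetric]) simp
  also have "(\<Sum>a<M. (int (part p a + (M - 1 - a)) - i) div int e) = (\<Sum>x\<in>beads M p. (int x - i) div int e)"
    unfolding beads_def by (subst sum.reindex[OF inj_on_beads[OF p(1)]]) simp
  finally show ?thesis .
qed

text \<open>
  The elements of \<open>X\<close> in decreasing order, with the beads of the empty partition subtracted, are the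
  parts.
\<close>

lemma ex_partition_beads:
  assumes "finite X" "card X = M"
  shows "\<exists>p \<in> partitions. length p \<le> M \<and> beads M p = X"
proof -
  define xs where "xs = rev (sorted_list_of_set X)"
  have xs: "length xs = M" "set xs = X" using assms by (auto simp: xs_def)
  have dec: "sorted_wrt (>) xs"
    unfolding xs_def by (simp add: sorted_wrt_rev)
  have gap: "xs ! b + (b - a) \<le> xs ! a" if "a \<le> b" "b < M" for a b
    using that
  proof (induction "b - a" arbitrary: b)
    case 0
    then show ?case by simp
  next
    case (Suc d)
    then have "xs ! (b - 1) + (b - 1 - a) \<le> xs ! a" by (intro Suc.hyps(1)) auto
    moreover have "xs ! b < xs ! (b - 1)"
      using sorted_wrt_nth_less[OF dec, of "b - 1" b] Suc xs by auto
    ultimately show ?case using Suc by simp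
  qed
  have low: "M - 1 - a \<le> xs ! a" if "a < M" for a
  proof -
    have "a \<le> M - 1" using that by simp
    then show ?thesis using gap[of a "M - 1"] that by linarith
  qed
  define q where "q = map (\<lambda>a. xs ! a - (M - 1 - a)) [0..<M]"
  have q: "length q = M" "\<And>a. a < M \<Longrightarrow> q ! a = xs ! a - (M - 1 - a)" by (auto simp: q_def)
  have qdec: "sorted_wrt (\<ge>) q"
  proof (unfold sorted_wrt_iff_nth_less, intro allI impI)
    fix a b assume "a < b" "b < length q"
    then show "q ! a \<ge> q ! b" using gap[of a b] low[of a] low[of b] q by simp
  qed
  define p where "p = takeWhile (\<lambda>x. 0 < x) q"
  have p: "p \<in> partitions" "length p \<le> M"
    using qdec sorted_wrt_takeWhile[of "(\<ge>)" q] set_takeWhileD[of _ "\<lambda>x. 0 < x" q]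
      length_takeWhile_le[of "\<lambda>x. 0 < x" q] q
    by (auto simp: partitions_def p_def)
  have part: "part p a = q ! a" if "a < M" for a
  proof (cases "a < length p")
    case True
    then show ?thesis by (simp add: part_def p_def takeWhile_nth)
  next
    case False
    then have "length p < length q" using that q by simp
    then have "q ! length p = 0" unfolding p_def using nth_length_takeWhile by blast
    moreover have "q ! a \<le> q ! length p"
      using sorted_wrt_nth_less[OF qdec, of "length p" a] False that q
      by (cases "a = length p") auto
    ultimately show ?thesis using False by (simp add: part_def)
  qed
  have "beads M p = (\<lambda>a. xs ! a) ` {..<M}"
    unfolding beads_def using part q(2) low by (intro image_cong refl) (simp only: lessThan_iff le_add_diff_inverse2)
  also have "\<dots> = X" using xs by (auto simp: set_conv_nth)
  finally show ?thesis using p by blast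
qed

definition runner :: "nat \<Rightarrow> nat set \<Rightarrow> nat \<Rightarrow> nat" where
  "runner e X k = card {x \<in> X. x mod e = k}"

definition level :: "nat \<Rightarrow> nat set \<Rightarrow> nat" where
  "level e X = (\<Sum>x\<in>X. x div e)"

text \<open>
  Subtracting \<open>i \<le> e\<close> before dividing lowers the quotient by one exactly for the beads on the first
  \<open>i\<close> runners.
\<close>

lemma sum_div_eq_level:
  assumes e: "e > 0" and "finite X" and i: "i \<le> e"
  shows "(\<Sum>x\<in>X. (int x - int i) div int e) = int (level e X) - (\<Sum>k<i. int (runner e X k))"
proof -
  have *: "(int x - int i) div int e = int (x div e) - of_bool (x mod e < i)" for x
  proof -
    have x: "int x = int (x div e) * int e + int (x mod e)"
      by (metis div_mult_mod_eq of_nat_add of_nat_mult)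
    show ?thesis
    proof (cases "x mod e < i")
      case True
      have "(int x - int i) div int e = int (x div e) - 1"
        using True x i by (intro int_div_pos_eq[of _ _ _ "int (x mod e) - int i + int e"])
          (simp_all add: algebra_simps)
      then show ?thesis using True by simp
    next
      case False
      moreover have "x mod e < e" using e by simp
      ultimately have "(int x - int i) div int e = int (x div e)"
        using x by (intro int_div_pos_eq[of _ _ _ "int (x mod e) - int i"])
          (simp_all add: algebra_simps)
      then show ?thesis using False by simp
    qed
  qed
  have "(\<Sum>k<i. int (runner e X k)) = int (card (\<Union>k\<in>{..<i}. {x \<in> X. x mod e = k}))"
    using assms(2) by (subst card_UN_disjoint) (auto simp: runner_def)
  also have "(\<Union>k\<in>{..<i}. {x \<in> X. x mod e = k}) = X \<inter> {x. x mod e < i}" by auto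
  also have "int (card \<dots>) = (\<Sum>x\<in>X. of_bool (x mod e < i))"
    using assms(2) by (simp add: Int_def)
  finally show ?thesis by (simp add: * sum_subtractf level_def)
qed

lemma sum_runner:
  assumes "e > 0" "finite X"
  shows "(\<Sum>k<e. runner e X k) = card X"
proof -
  have "(\<Sum>k<e. runner e X k) = card (\<Union>k\<in>{..<e}. {x \<in> X. x mod e = k})"
    using assms(2) by (subst card_UN_disjoint) (auto simp: runner_def)
  also have "(\<Union>k\<in>{..<e}. {x \<in> X. x mod e = k}) = X" using assms by auto
  finally show ?thesis .
qed

lemma twice_sum_lessThan: "2 * (\<Sum>t<m. t) = m * (m - 1)" for m :: nat
  by (induction m) (auto simp: algebra_simps)

lemma triangle_le_sum:
  fixes A :: "nat set"
  assumes "finite A"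
  shows "card A * (card A - 1) \<le> 2 * \<Sum>A"
  using assms
proof (induction A rule: finite_linorder_max_induct)
  case empty
  then show ?case by simp
next
  case (insert b A)
  have "card A \<le> b"
    using insert card_mono[of "{..<b}" A] by auto
  moreover have "card (insert b A) = Suc (card A)" using insert by auto
  moreover have "\<Sum>(insert b A) = b + \<Sum>A" using insert by auto
  moreover have "Suc (card A) * card A = card A * (card A - 1) + 2 * card A"
    by (cases "card A") auto
  ultimately show ?case using insert by simp
qed

text \<open>
  Equality holds when the beads of each runner are pushed down as far as possible, that is for the bead
  sets of \<open>e\<close>-cores.
\<close>

lemma triangle_le_level:
  assumes "e > 0" "finite X"
  shows "(\<Sum>k<e. runner e X k * (runner e X k - 1)) \<le> 2 * level e X"
proof -
  have "runner e X k * (runner e X k - 1) \<le> 2 * (\<Sum>x\<in>{x \<in> X. x mod e = k}. x div e)" for k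
  proof -
    have inj: "inj_on (\<lambda>x. x div e) {x \<in> X. x mod e = k}"
      by (intro inj_onI) (metis (mono_tags, lifting) div_mult_mod_eq mem_Collect_eq)
    have "card ((\<lambda>x. x div e) ` {x \<in> X. x mod e = k}) = runner e X k"
      using inj by (simp add: card_image runner_def)
    moreover have "\<Sum>((\<lambda>x. x div e) ` {x \<in> X. x mod e = k}) = (\<Sum>x\<in>{x \<in> X. x mod e = k}. x div e)"
      using inj by (simp add: sum.reindex)
    ultimately show ?thesis
      using triangle_le_sum[of "(\<lambda>x. x div e) ` {x \<in> X. x mod e = k}"] assms(2) by simp
  qed
  then have "(\<Sum>k<e. runner e X k * (runner e X k - 1)) \<le> (\<Sum>k<e. 2 * (\<Sum>x\<in>{x \<in> X. x mod e = k}. x div e))"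
    by (intro sum_mono)
  also have "\<dots> = 2 * level e X"
  proof -
    have "(\<lambda>x. x mod e) ` X \<subseteq> {..<e}" using assms by auto
    then show ?thesis
      using assms sum.group[of X "{..<e}" "\<lambda>x. x mod e" "\<lambda>x. x div e"]
      by (simp add: level_def sum_distrib_left[symmetric])
  qed
  finally show ?thesis .
qed

text \<open>
  Push all beads down and then raise the top bead of runner \<open>k0\<close> by \<open>w\<close> positions.
\<close>

lemma ex_bead_set:
  assumes e: "e > 0" and pos: "k0 < e" "n k0 > 0"
  shows "\<exists>X. finite X \<and> (\<forall>k<e. runner e X k = n k) \<and> 2 * level e X = (\<Sum>k<e. n k * (n k - 1)) + 2 * w"
proof -
  define h where "h k t = (if k = k0 \<and> t = n k0 - 1 then t + w else t)" for k t
  define g where "g = (\<lambda>(k, t). k + e * h k t)"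
  define X where "X = g ` (SIGMA k:{..<e}. {..<n k})"
  have g: "g (k, t) mod e = k" "g (k, t) div e = h k t" if "k < e" for k t
    using that by (auto simp: g_def)
  have hinj: "t = t'" if "h k t = h k t'" "t < n k" "t' < n k" for k t t'
    using that by (auto simp: h_def split: if_splits)
  have inj: "inj_on g (SIGMA k:{..<e}. {..<n k})"
  proof (rule inj_onI)
    fix x y assume "x \<in> (SIGMA k:{..<e}. {..<n k})" "y \<in> (SIGMA k:{..<e}. {..<n k})" "g x = g y"
    moreover obtain a b c d where "x = (a, b)" "y = (c, d)" by fastforce
    ultimately show "x = y" using g[of a b] g[of c d] hinj[of a b d] by auto
  qed
  have "runner e X k = n k" if "k < e" for k
  proof -
    have "{x \<in> X. x mod e = k} = g ` ({k} \<times> {..<n k})"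
      using that g by (auto simp: X_def)
    moreover have "inj_on g ({k} \<times> {..<n k})" using inj by (rule inj_on_subset) (use that in auto)
    ultimately show ?thesis by (simp add: runner_def card_image)
  qed
  moreover have "2 * level e X = (\<Sum>k<e. n k * (n k - 1)) + 2 * w"
  proof -
    have "level e X = (\<Sum>(k, t)\<in>(SIGMA k:{..<e}. {..<n k}). h k t)"
      unfolding level_def X_def by (subst sum.reindex[OF inj]) (auto simp: g intro!: sum.cong)
    also have "\<dots> = (\<Sum>k<e. \<Sum>t<n k. h k t)" by (subst sum.Sigma) auto
    also have "\<dots> = (\<Sum>k<e. (\<Sum>t<n k. t) + (if k = k0 then w else 0))"
    proof (intro sum.cong refl)
      fix k
      have "(\<Sum>t<n k. h k t) = (\<Sum>t<n k. t + (if t = n k0 - 1 \<and> k = k0 then w else 0))"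
        by (intro sum.cong) (auto simp: h_def)
      also have "\<dots> = (\<Sum>t<n k. t) + (\<Sum>t<n k. if t = n k0 - 1 then (if k = k0 then w else 0) else 0)"
        by (subst sum.distrib) (auto intro: sum.cong)
      also have "(\<Sum>t<n k. if t = n k0 - 1 then (if k = k0 then w else 0) else 0) = (if k = k0 then w else 0)"
        using pos by simp
      finally show "(\<Sum>t<n k. h k t) = (\<Sum>t<n k. t) + (if k = k0 then w else 0)" .
    qed
    also have "\<dots> = (\<Sum>k<e. \<Sum>t<n k. t) + w" using pos by (simp add: sum.distrib)
    finally have "2 * level e X = (\<Sum>k<e. 2 * (\<Sum>t<n k. t)) + 2 * w" by (simp add: sum_distrib_left)
    then show ?thesis by (simp only: twice_sum_lessThan)
  qed
  ultimately show ?thesis by (intro exI[of _ X]) (auto simp: X_def)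
qed

section \<open>Content and weight on the abacus\<close>

text \<open>
  The bead number of a component has to be congruent to its charge. Numbers in the common window from
  \<open>K * e\<close> to \<open>K * e + e - 1\<close> are chosen because then the empty component \<open>j\<close> has \<open>K + 1\<close> beads on the
  runners below \<open>s j mod e\<close> and \<open>K\<close> beads on the others; the weight formula rests on this.
\<close>

definition bead_number :: "nat \<Rightarrow> nat \<Rightarrow> (nat \<Rightarrow> int) \<Rightarrow> nat \<Rightarrow> nat" where
  "bead_number e K s j = K * e + nat (s j mod int e)"

definition empty_matrix :: "nat \<Rightarrow> nat \<Rightarrow> (nat \<Rightarrow> int) \<Rightarrow> nat \<Rightarrow> nat \<Rightarrow> nat" where
  "empty_matrix e K s j k = K + of_bool (k < nat (s j mod int e))"

definition fits :: "nat \<Rightarrow> nat \<Rightarrow> nat \<Rightarrow> (nat \<Rightarrow> int) \<Rightarrow> (nat \<Rightarrow> nat list) \<Rightarrow> bool" where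
  "fits r e K s L \<longleftrightarrow> L \<in> multipartitions r \<and> (\<forall>j\<in>{1..r}. length (L j) \<le> bead_number e K s j)"

definition bead_matrix :: "nat \<Rightarrow> nat \<Rightarrow> (nat \<Rightarrow> int) \<Rightarrow> (nat \<Rightarrow> nat list) \<Rightarrow> nat \<Rightarrow> nat \<Rightarrow> nat" where
  "bead_matrix e K s L j k = runner e (beads (bead_number e K s j) (L j)) k"

definition total_level :: "nat \<Rightarrow> nat \<Rightarrow> nat \<Rightarrow> (nat \<Rightarrow> int) \<Rightarrow> (nat \<Rightarrow> nat list) \<Rightarrow> nat" where
  "total_level r e K s L = (\<Sum>j=1..r. level e (beads (bead_number e K s j) (L j)))"

lemma
  assumes e: "e > 0" and "\<tau> \<le> e"
  shows runner_lessThan: "k < e \<Longrightarrow> runner e {..<K * e + \<tau>} k = K + of_bool (k < \<tau>)"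
    and level_lessThan: "2 * level e {..<K * e + \<tau>} =
      (\<Sum>k<e. (K + of_bool (k < \<tau>)) * (K + of_bool (k < \<tau>) - 1))"
proof -
  have set: "{x \<in> {..<K * e + \<tau>}. x mod e = k} = (\<lambda>t. k + e * t) ` {..<K + of_bool (k < \<tau>)}"
    if k: "k < e" for k
  proof (intro set_eqI iffI)
    fix x assume x: "x \<in> {x \<in> {..<K * e + \<tau>}. x mod e = k}"
    define t where "t = x div e"
    have xt: "x = k + t * e" "x < K * e + \<tau>" using x by (auto simp: t_def)
    have "t < K + of_bool (k < \<tau>)"
    proof (rule ccontr)
      assume "\<not> ?thesis"
      then have "K + of_bool (k < \<tau>) \<le> t" by simp
      then have "(K + of_bool (k < \<tau>)) * e \<le> t * e" by (rule mult_le_mono1)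
      then have "K * e + of_bool (k < \<tau>) * e \<le> t * e" by (simp only: add_mult_distrib)
      moreover have "\<tau> \<le> k + of_bool (k < \<tau>) * e" using assms by auto
      ultimately show False using xt by linarith
    qed
    then show "x \<in> (\<lambda>t. k + e * t) ` {..<K + of_bool (k < \<tau>)}" using xt by (auto simp: mult.commute)
  next
    fix x assume "x \<in> (\<lambda>t. k + e * t) ` {..<K + of_bool (k < \<tau>)}"
    then obtain t where t: "x = k + e * t" "t < K + of_bool (k < \<tau>)" by auto
    have "x < K * e + \<tau>"
    proof (cases "t < K")
      case True
      then have "e * (t + 1) \<le> e * K" by (intro mult_le_mono2) simp
      then show ?thesis using t k by (simp add: mult.commute)
    next
      case False
      then have "t = K \<and> k < \<tau>" using t by (cases "k < \<tau>") auto
      then show ?thesis using t by (simp add: mult.commute)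
    qed
    then show "x \<in> {x \<in> {..<K * e + \<tau>}. x mod e = k}" using t k by simp
  qed
  have inj: "inj_on (\<lambda>t. k + e * t) A" for k A using e by (auto intro!: inj_onI)
  show "runner e {..<K * e + \<tau>} k = K + of_bool (k < \<tau>)" if "k < e"
    unfolding runner_def set[OF that] by (subst card_image[OF inj]) simp
  have "(\<lambda>x. x mod e) ` {..<K * e + \<tau>} \<subseteq> {..<e}" using e by auto
  then have "level e {..<K * e + \<tau>} = (\<Sum>k<e. \<Sum>x\<in>{x \<in> {..<K * e + \<tau>}. x mod e = k}. x div e)"
    using sum.group[of "{..<K * e + \<tau>}" "{..<e}" "\<lambda>x. x mod e" "\<lambda>x. x div e"] by (simp add: level_def)
  also have "\<dots> = (\<Sum>k<e. \<Sum>t<K + of_bool (k < \<tau>). t)"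
  proof (rule sum.cong[OF refl])
    fix k assume "k \<in> {..<e}"
    then have k: "k < e" by simp
    show "(\<Sum>x\<in>{x \<in> {..<K * e + \<tau>}. x mod e = k}. x div e) = (\<Sum>t<K + of_bool (k < \<tau>). t)"
      unfolding set[OF k] sum.reindex[OF inj] using k by simp
  qed
  finally have "2 * level e {..<K * e + \<tau>} = (\<Sum>k<e. 2 * (\<Sum>t<K + of_bool (k < \<tau>). t))"
    by (simp add: sum_distrib_left)
  then show "2 * level e {..<K * e + \<tau>} =
      (\<Sum>k<e. (K + of_bool (k < \<tau>)) * (K + of_bool (k < \<tau>) - 1))"
    by (simp only: twice_sum_lessThan)
qed

lemma nat_mod_less: "e > 0 \<Longrightarrow> nat (x mod int e) < e"
  by (simp add: nat_less_iff)

lemma fitsD: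
  assumes "fits r e K s L" "j \<in> {1..r}"
  shows "L j \<in> partitions" "length (L j) \<le> bead_number e K s j"
  using assms by (auto simp: fits_def multipartitions_def)

lemma bead_matrix_row_sum:
  assumes "e > 0" "fits r e K s L" "j \<in> {1..r}"
  shows "(\<Sum>k<e. bead_matrix e K s L j k) = bead_number e K s j"
  using assms fitsD by (simp add: bead_matrix_def sum_runner finite_beads card_beads)

lemma empty_matrix_row_sum:
  assumes "e > 0"
  shows "(\<Sum>k<e. empty_matrix e K s j k) = bead_number e K s j"
proof -
  have "(\<Sum>k<e. empty_matrix e K s j k) = (\<Sum>k<e. runner e {..<bead_number e K s j} k)"
    using assms nat_mod_less[OF assms, of "s j"]
    by (intro sum.cong refl) (simp add: empty_matrix_def bead_number_def runner_lessThan)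
  then show ?thesis using sum_runner[OF assms, of "{..<bead_number e K s j}"] by simp
qed

text \<open>
  Between consecutive residues the content changes by the difference of column sums; the common offset
  is the total level. At \<open>i = e\<close> the value is the same as at \<open>i = 0\<close> because the row sums agree, which
  lets differences \<open>c\<^sub>k - c\<^sub>k\<^sub>+\<^sub>1\<close> be handled without reduction modulo \<open>e\<close>.
\<close>

lemma content_bead_matrix:
  assumes e: "e > 0" and L: "fits r e K s L" and i: "i \<le> e"
  shows "content r e s L (int i) =
    (int (total_level r e K s L) - (\<Sum>j=1..r. int (level e {..<bead_number e K s j})))
    - (\<Sum>k<i. (\<Sum>j=1..r. int (bead_matrix e K s L j k)) - (\<Sum>j=1..r. int (empty_matrix e K s j k)))"
proof -
  have 1: "int (comp_count e (s j) (L j) (int i)) =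
     (int (level e (beads (bead_number e K s j) (L j))) - int (level e {..<bead_number e K s j}))
     - (\<Sum>k<i. int (bead_matrix e K s L j k) - int (empty_matrix e K s j k))" if j: "j \<in> {1..r}" for j
  proof -
    have "int (bead_number e K s j) mod int e = s j mod int e"
      using e by (simp add: bead_number_def)
    then have "int (comp_count e (s j) (L j) (int i)) =
      (\<Sum>x\<in>beads (bead_number e K s j) (L j). (int x - int i) div int e)
      - (\<Sum>x<bead_number e K s j. (int x - int i) div int e)"
      using comp_count_beads[OF e] fitsD[OF L j] by blast
    also have "\<dots> = (int (level e (beads (bead_number e K s j) (L j)))
        - (\<Sum>k<i. int (bead_matrix e K s L j k)))
      - (int (level e {..<bead_number e K s j}) - (\<Sum>k<i. int (runner e {..<bead_number e K s j} k)))"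
      using e i by (simp only: sum_div_eq_level finite_beads finite_lessThan bead_matrix_def)
    also have "(\<Sum>k<i. int (runner e {..<bead_number e K s j} k)) = (\<Sum>k<i. int (empty_matrix e K s j k))"
      using e i nat_mod_less[OF e, of "s j"]
      by (intro sum.cong refl) (simp add: empty_matrix_def bead_number_def runner_lessThan)
    finally show ?thesis by (simp add: sum_subtractf)
  qed
  have "content r e s L (int i) = (\<Sum>j=1..r. int (comp_count e (s j) (L j) (int i)))"
    by (simp add: content_def res_count_sum)
  also have "\<dots> = (\<Sum>j=1..r. (int (level e (beads (bead_number e K s j) (L j))) - int (level e {..<bead_number e K s j}))
     - (\<Sum>k<i. int (bead_matrix e K s L j k) - int (empty_matrix e K s j k)))"
    by (intro sum.cong refl 1) auto
  also have "\<dots> = (int (total_level r e K s L) - (\<Sum>j=1..r. int (level e {..<bead_number e K s j})))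
    - (\<Sum>k<i. (\<Sum>j=1..r. int (bead_matrix e K s L j k)) - (\<Sum>j=1..r. int (empty_matrix e K s j k)))"
    by (simp add: sum_subtractf total_level_def sum.swap[of _ "{..<i}"])
  finally show ?thesis .
qed

lemma content_mod: "content r e s L i = content r e s L (i mod int e)"
  by (simp add: content_def res_count_def)

lemma sum_int_lessThan: "(\<Sum>i\<in>{0..<int e}. f i) = (\<Sum>k<e. f (int k))"
  by (rule sum.reindex_bij_witness[of _ int nat]) auto

lemma weight_content:
  "weight r e s L = (\<Sum>j=1..r. real_of_int (content r e s L (s j)))
     - 1 / 2 * (\<Sum>k<e. (real_of_int (content r e s L (int k) - content r e s L (int (Suc k))))\<^sup>2)"
  by (simp add: weight_def content_def sum_int_lessThan add.commute)

text \<open>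
  With \<open>D = m - v\<close> the difference of the column sums, the quadratic part of the weight is
  \<open>(\<Sum>\<^sub>k D\<^sub>k\<^sup>2) / 2\<close>. In the linear part the sum of \<open>D\<close> over the runners below \<open>s j mod e\<close>, taken over
  all \<open>j\<close>, is \<open>\<Sum>\<^sub>k D\<^sub>k v\<^sub>k\<close>, because \<open>v\<^sub>k - r * K\<close> counts the components \<open>j\<close> with \<open>k < s j mod e\<close> and
  \<open>D\<close> sums to zero. Completing the square gives the difference of the sums of squares of the columns.
\<close>

lemma weight_bead_matrix:
  assumes e: "e > 0" and L: "fits r e K s L"
  shows "weight r e s L =
    real r * (real (total_level r e K s L) - 1 / 2 * (\<Sum>j=1..r. \<Sum>k<e. real (empty_matrix e K s j k) * (real (empty_matrix e K s j k) - 1)))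
    - 1 / 2 * ((\<Sum>k<e. (real (\<Sum>j=1..r. bead_matrix e K s L j k))\<^sup>2) - (\<Sum>k<e. (real (\<Sum>j=1..r. empty_matrix e K s j k))\<^sup>2))"
proof -
  define m where "m k = (\<Sum>j=1..r. int (bead_matrix e K s L j k))" for k
  define v where "v k = (\<Sum>j=1..r. int (empty_matrix e K s j k))" for k
  define D where "D k = m k - v k" for k
  define t where "t = int (total_level r e K s L) - (\<Sum>j=1..r. int (level e {..<bead_number e K s j}))"
  have c: "content r e s L (int i) = t - (\<Sum>k<i. D k)" if "i \<le> e" for i
    using content_bead_matrix[OF e L that] by (simp add: t_def D_def m_def v_def)
  have D0: "(\<Sum>k<e. D k) = 0"
  proof -
    have "(\<Sum>k<e. m k) = int (\<Sum>j=1..r. \<Sum>k<e. bead_matrix e K s L j k)"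
      unfolding m_def by (subst sum.swap) simp
    also have "\<dots> = int (\<Sum>j=1..r. \<Sum>k<e. empty_matrix e K s j k)"
      using bead_matrix_row_sum[OF e L] empty_matrix_row_sum[OF e] by simp
    also have "\<dots> = (\<Sum>k<e. v k)" unfolding v_def by (subst (2) sum.swap) simp
    finally show ?thesis by (simp add: D_def sum_subtractf)
  qed
  have "(\<Sum>j=1..r. content r e s L (s j)) = (\<Sum>j=1..r. t - (\<Sum>k<e. D k * of_bool (k < nat (s j mod int e))))"
  proof (intro sum.cong refl)
    fix j
    let ?\<tau> = "nat (s j mod int e)"
    have \<tau>: "?\<tau> < e" "int ?\<tau> = s j mod int e" using nat_mod_less[OF e] e by auto
    have "content r e s L (s j) = t - (\<Sum>k<?\<tau>. D k)"
      using c[of ?\<tau>] \<tau> content_mod[of r e s L "s j"] by simp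
    also have "(\<Sum>k<?\<tau>. D k) = (\<Sum>k<e. D k * of_bool (k < ?\<tau>))"
      using \<tau> by (intro sum.mono_neutral_cong_left) auto
    finally show "content r e s L (s j) = t - (\<Sum>k<e. D k * of_bool (k < ?\<tau>))" .
  qed
  also have "\<dots> = int r * t - (\<Sum>k<e. D k * (\<Sum>j=1..r. of_bool (k < nat (s j mod int e))))"
    by (simp only: sum_subtractf sum_distrib_left sum.swap[of _ "{..<e}"]) simp
  also have "(\<Sum>k<e. D k * (\<Sum>j=1..r. of_bool (k < nat (s j mod int e)))) = (\<Sum>k<e. D k * v k - int r * int K * D k)"
    by (intro sum.cong refl) (simp add: v_def empty_matrix_def sum.distrib algebra_simps)
  also have "\<dots> = (\<Sum>k<e. D k * v k)"
    using D0 by (simp add: sum_subtractf sum_distrib_left[symmetric])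
  finally have 1: "(\<Sum>j=1..r. content r e s L (s j)) = int r * t - (\<Sum>k<e. D k * v k)" .
  have 2: "(\<Sum>k<e. (content r e s L (int k) - content r e s L (int (Suc k)))\<^sup>2) = (\<Sum>k<e. (D k)\<^sup>2)"
    using c by (intro sum.cong refl) (simp del: of_nat_Suc)
  have 3: "2 * (\<Sum>k<e. D k * v k) + (\<Sum>k<e. (D k)\<^sup>2) = (\<Sum>k<e. (m k)\<^sup>2) - (\<Sum>k<e. (v k)\<^sup>2)"
    by (simp add: sum_distrib_left sum.distrib[symmetric] sum_subtractf[symmetric] D_def power2_eq_square algebra_simps)
  have "weight r e s L = real_of_int (int r * t - (\<Sum>k<e. D k * v k)) - 1 / 2 * real_of_int (\<Sum>k<e. (D k)\<^sup>2)"
    unfolding weight_content 1[symmetric] 2[symmetric] by simp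
  also have "\<dots> = real r * t - 1 / 2 * real_of_int (2 * (\<Sum>k<e. D k * v k) + (\<Sum>k<e. (D k)\<^sup>2))"
    by (simp add: field_simps)
  also have "\<dots> = real r * t - 1 / 2 * ((\<Sum>k<e. (real_of_int (m k))\<^sup>2) - (\<Sum>k<e. (real_of_int (v k))\<^sup>2))"
    unfolding 3 by simp
  also have "real_of_int t = real (total_level r e K s L) - 1 / 2 * (\<Sum>j=1..r. \<Sum>k<e. real (empty_matrix e K s j k) * (real (empty_matrix e K s j k) - 1))"
  proof -
    have "2 * real (level e {..<bead_number e K s j}) = (\<Sum>k<e. real (empty_matrix e K s j k) * (real (empty_matrix e K s j k) - 1))" for j
    proof -
      have "2 * level e {..<bead_number e K s j} = (\<Sum>k<e. empty_matrix e K s j k * (empty_matrix e K s j k - 1))"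
        using level_lessThan[OF e less_imp_le[OF nat_mod_less[OF e]]] by (simp add: bead_number_def empty_matrix_def)
      moreover have "real (n * (n - 1)) = real n * (real n - 1)" for n
        by (cases n) (auto simp: algebra_simps)
      ultimately show ?thesis by (metis (mono_tags, lifting) of_nat_mult of_nat_numeral of_nat_sum sum.cong)
    qed
    then have "(\<Sum>j=1..r. \<Sum>k<e. real (empty_matrix e K s j k) * (real (empty_matrix e K s j k) - 1)) =
        2 * (\<Sum>j=1..r. real (level e {..<bead_number e K s j}))"
      by (simp only: sum_distrib_left)
    then show ?thesis by (simp add: t_def)
  qed
  finally show ?thesis by (simp add: m_def v_def)
qed

text \<open>
  The differences \<open>c\<^sub>k - c\<^sub>k\<^sub>+\<^sub>1\<close> sum to zero around the circle, so the sum of their squares is even.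
\<close>

lemma weight_Ints: 
  assumes e: "e > 0"
  shows "weight r e s L \<in> \<int>"
proof -
  define d where "d k = content r e s L (int k) - content r e s L (int (Suc k))" for k
  have "(\<Sum>k<e. d k) = content r e s L (int 0) - content r e s L (int e)"
    unfolding d_def by (rule sum_lessThan_telescope')
  also have "\<dots> = 0" using content_mod[of r e s L "int e"] by simp
  finally have d0: "(\<Sum>k<e. d k) = 0" .
  have "even (\<Sum>k<e. (d k)\<^sup>2 - d k)" by (intro dvd_sum) (auto simp: power2_eq_square)
  then obtain q where "(\<Sum>k<e. (d k)\<^sup>2) = 2 * q" using d0 by (auto simp: sum_subtractf)
  then have "(\<Sum>k<e. (real_of_int (d k))\<^sup>2) = 2 * real_of_int q"
    by (metis (mono_tags, lifting) of_int_mult of_int_numeral of_int_power of_int_sum sum.cong)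
  then show ?thesis unfolding weight_content d_def[symmetric] by (auto intro: Ints_sum)
qed

text \<open>
  Every natural matrix with the right row sums is displayed by a multipartition, at every level from
  the least one upwards; the surplus \<open>w\<close> is placed in the first component.
\<close>

lemma ex_bead_matrix:
  assumes e: "e > 0" and r: "r > 0" and pos: "bead_number e K s 1 > 0"
    and row: "\<And>j. j \<in> {1..r} \<Longrightarrow> (\<Sum>k<e. y j k) = bead_number e K s j"
  obtains L where "fits r e K s L" "\<And>j k. j \<in> {1..r} \<Longrightarrow> k < e \<Longrightarrow> bead_matrix e K s L j k = y j k"
    "2 * total_level r e K s L = (\<Sum>j=1..r. \<Sum>k<e. y j k * (y j k - 1)) + 2 * w"
proof -
  obtain k1 where k1: "k1 < e" "y 1 k1 > 0"
    using row[of 1] pos r by (metis atLeastAtMost_iff le_refl lessThan_iff less_one neq0_conv not_less sum.neutral)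
  have "\<exists>X. finite X \<and> (\<forall>k<e. runner e X k = y j k) \<and>
      2 * level e X = (\<Sum>k<e. y j k * (y j k - 1)) + (if j = 1 then 2 * w else 0)" for j
  proof (cases "\<exists>k<e. y j k > 0")
    case True
    then obtain k where "k < e" "y j k > 0" by blast
    then show ?thesis using ex_bead_set[OF e, of k "y j" "if j = 1 then w else 0"] by auto
  next
    case False
    then have "j \<noteq> 1" using k1 by auto
    then show ?thesis using False by (intro exI[of _ "{}"]) (auto simp: runner_def level_def)
  qed
  then obtain X where X: "\<And>j. finite (X j)" "\<And>j k. k < e \<Longrightarrow> runner e (X j) k = y j k"
      "\<And>j. 2 * level e (X j) = (\<Sum>k<e. y j k * (y j k - 1)) + (if j = 1 then 2 * w else 0)"
    by metis
  have "card (X j) = bead_number e K s j" if "j \<in> {1..r}" for j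
    using sum_runner[OF e X(1)[of j]] X(2) row[OF that] by simp
  then have "\<forall>j\<in>{1..r}. \<exists>p. p \<in> partitions \<and> length p \<le> bead_number e K s j \<and> beads (bead_number e K s j) p = X j"
    using ex_partition_beads[OF X(1)] by blast
  then obtain L0 where L0: "\<And>j. j \<in> {1..r} \<Longrightarrow> L0 j \<in> partitions \<and> length (L0 j) \<le> bead_number e K s j
      \<and> beads (bead_number e K s j) (L0 j) = X j"
    by metis
  define L where "L = restrict L0 {1..r}"
  have "fits r e K s L" using L0 by (auto simp: fits_def multipartitions_def L_def)
  moreover have "bead_matrix e K s L j k = y j k" if "j \<in> {1..r}" "k < e" for j k
    using that L0 X(2) by (simp add: bead_matrix_def L_def)
  moreover have "2 * total_level r e K s L = (\<Sum>j=1..r. \<Sum>k<e. y j k * (y j k - 1)) + 2 * w"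
  proof -
    have "total_level r e K s L = (\<Sum>j=1..r. level e (X j))"
      using L0 by (simp add: total_level_def L_def)
    then have "2 * total_level r e K s L = (\<Sum>j=1..r. (\<Sum>k<e. y j k * (y j k - 1)) + (if j = 1 then 2 * w else 0))"
      using X(3) by (simp add: sum_distrib_left)
    also have "\<dots> = (\<Sum>j=1..r. \<Sum>k<e. y j k * (y j k - 1)) + 2 * w"
      using r by (simp add: sum.distrib)
    finally show ?thesis .
  qed
  ultimately show thesis using that by blast
qed

lemma content_minus_delta:
  assumes e: "e > 0" and L: "fits r e K s L" "fits r e K s L'"
    and col: "\<And>k. k < e \<Longrightarrow> (\<Sum>j=1..r. bead_matrix e K s L' j k) = (\<Sum>j=1..r. bead_matrix e K s L j k)"
    and lev: "Suc (total_level r e K s L') = total_level r e K s L"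
  shows "content r e s L' = content r e s L - delta"
proof
  fix i
  let ?i = "nat (i mod int e)"
  have i: "?i < e" "int ?i = i mod int e" using nat_mod_less[OF e] e by auto
  have col': "(\<Sum>j=1..r. int (bead_matrix e K s L' j k)) = (\<Sum>j=1..r. int (bead_matrix e K s L j k))" if "k < ?i" for k
    using col[of k] that i by (simp flip: of_nat_sum)
  have "content r e s L' (int ?i) = content r e s L (int ?i) - 1"
    using content_bead_matrix[OF e L(1), of ?i] content_bead_matrix[OF e L(2), of ?i] i lev[symmetric] col' by simp
  then show "content r e s L' i = (content r e s L - delta) i"
    using content_mod[of r e s L i] content_mod[of r e s L' i] i by (simp add: delta_def)
qed

text \<open>
  Otherwise \<open>y\<close>, raised to the total level of \<open>L\<close> minus one, would display a multipartition whose
  content is that of \<open>L\<close> minus \<open>\<delta>\<close>.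
\<close>

lemma reduced_total_level_le:
  assumes e: "e > 0" and r: "r > 0" and pos: "bead_number e K s 1 > 0"
    and L: "fits r e K s L" "L \<in> reduced_multicores r e s"
    and row: "\<And>j. j \<in> {1..r} \<Longrightarrow> (\<Sum>k<e. y j k) = bead_number e K s j"
    and col: "\<And>k. k < e \<Longrightarrow> (\<Sum>j=1..r. y j k) = (\<Sum>j=1..r. bead_matrix e K s L j k)"
  shows "2 * total_level r e K s L \<le> (\<Sum>j=1..r. \<Sum>k<e. y j k * (y j k - 1))"
proof (rule ccontr)
  assume less: "\<not> ?thesis"
  have "even (\<Sum>j=1..r. \<Sum>k<e. y j k * (y j k - 1))" by (intro dvd_sum) auto
  then obtain a where a: "(\<Sum>j=1..r. \<Sum>k<e. y j k * (y j k - 1)) = 2 * a" by blast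
  obtain L' where L': "fits r e K s L'" "\<And>j k. j \<in> {1..r} \<Longrightarrow> k < e \<Longrightarrow> bead_matrix e K s L' j k = y j k"
    "2 * total_level r e K s L' = (\<Sum>j=1..r. \<Sum>k<e. y j k * (y j k - 1)) + 2 * (total_level r e K s L - Suc a)"
    using ex_bead_matrix[OF e r pos row, where w = "total_level r e K s L - Suc a"] by blast
  have "content r e s L' = content r e s L - delta"
    using L'(2) col less a L'(3) by (intro content_minus_delta[OF e L(1) L'(1)]) auto
  moreover have "L' \<in> multipartitions r" using L'(1) by (simp add: fits_def)
  ultimately have "content r e s L - delta \<in> contents r e s" by (metis contents_def imageI)
  then show False using L(2) by (simp add: reduced_multicores_def)
qed

section \<open>The upper bound\<close>

text \<open>
  The rows beyond the length of \<open>p\<close> put beads on at least the positions \<open>0, \<dots>, e - 1\<close>.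
\<close>

lemma runner_beads_pos:
  assumes "length p + e \<le> M" "k < e"
  shows "0 < runner e (beads M p) k"
proof -
  have "part p (M - 1 - k) + (M - 1 - (M - 1 - k)) = k" "M - 1 - k < M"
    using assms by (auto simp: part_def)
  then have "k \<in> {x \<in> beads M p. x mod e = k}"
    using assms(2) unfolding beads_def by (auto intro!: image_eqI[of _ _ "M - 1 - k"])
  then show ?thesis
    unfolding runner_def by (subst card_gt_0_iff) (auto simp: finite_beads)
qed

lemma real_triangle: "real (n * (n - 1)) = (real n)\<^sup>2 - real n"
  by (cases n) (auto simp: power2_eq_square algebra_simps)

text \<open>
  The bound compares three matrices: the additive real matrix \<open>x\<close> with the margins of the bead matrix
  of \<open>L\<close>, its rounding \<open>y\<close>, to which minimality of the total level applies, and the matrix \<open>v\<close> of the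
  empty multipartition. The rows of \<open>v\<close> have the same sums, so the parts of the sums of squares that
  come from the rows cancel; the parts that come from the columns cancel against the last term of the
  weight formula.
\<close>

lemma reduced_weight_le:
  assumes e: "e > 0" and r: "r > 0" and L: "L \<in> reduced_multicores r e s"
  shows "weight r e s L \<le> (real r)\<^sup>2 / (2 * real e) * of_int \<lfloor>(real e)\<^sup>2 / 4\<rfloor>"
proof -
  \<comment> \<open>Large enough that every runner of every component carries a bead. Then \<open>m k / r \<ge> 1\<close>, while
      the other two terms of \<open>x j k\<close> below sum to at least \<open>-1\<close>, so \<open>x\<close> and \<open>y\<close> are nonnegative.\<close>
  define K where "K = Suc (\<Sum>j=1..r. length (L j))"
  define M where "M j = bead_number e K s j" for j
  have len: "length (L j) + e \<le> M j" if "j \<in> {1..r}" for j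
  proof -
    have "length (L j) \<le> (\<Sum>j=1..r. length (L j))" using that by (intro member_le_sum) auto
    also have "\<dots> * 1 \<le> (\<Sum>j=1..r. length (L j)) * e" using e by (intro mult_le_mono2) simp
    finally show ?thesis by (simp add: M_def bead_number_def K_def)
  qed
  have fits: "fits r e K s L"
    using L len by (force simp: fits_def reduced_multicores_def M_def)
  define n where "n = bead_matrix e K s L"
  define v where "v = empty_matrix e K s"
  define m where "m k = (\<Sum>j=1..r. n j k)" for k
  define S where "S = (\<Sum>j=1..r. M j)"
  have nrow: "(\<Sum>k<e. n j k) = M j" if "j \<in> {1..r}" for j
    using bead_matrix_row_sum[OF e fits that] by (simp add: n_def M_def)
  have vrow: "(\<Sum>k<e. v j k) = M j" for j
    using empty_matrix_row_sum[OF e] by (simp add: v_def M_def)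
  have mS: "(\<Sum>k<e. m k) = S"
    unfolding m_def S_def using nrow by (subst sum.swap) simp
  have mr: "r \<le> m k" if "k < e" for k
  proof -
    have "(\<Sum>j=1..r. 1) \<le> m k"
      unfolding m_def n_def bead_matrix_def
      using runner_beads_pos[OF len that] by (intro sum_mono) (auto simp: M_def Suc_le_eq)
    then show ?thesis by simp
  qed
  define x where "x j k = real (m k) / real r + real (M j) / real e - real S / (real r * real e)" for j k
  have xrow: "(\<Sum>k<e. x j k) = real (M j)" for j
    using mS e r by (simp add: x_def sum.distrib sum_subtractf sum_divide_distrib[symmetric] flip: of_nat_sum)
  have xcol: "(\<Sum>j=1..r. x j k) = real (m k)" for k
    using e r by (simp add: x_def sum.distrib sum_subtractf sum_divide_distrib[symmetric] S_def flip: of_nat_sum)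
  have xpos: "0 \<le> \<lfloor>x j k\<rfloor>" if "j \<in> {1..r}" "k < e" for j k
  proof -
    have "1 \<le> real (m k) / real r" using mr[OF that(2)] r by simp
    moreover have "K * e \<le> M j" by (simp add: M_def bead_number_def)
    then have "real K \<le> real (M j) / real e" using e by (simp add: field_simps flip: of_nat_mult)
    moreover have "real S / (real r * real e) \<le> real K + 1"
    proof -
      have "M i \<le> (K + 1) * e" for i
        using nat_mod_less[OF e, of "s i"] by (simp add: M_def bead_number_def)
      then have "S \<le> (\<Sum>j=1..r. (K + 1) * e)" unfolding S_def by (intro sum_mono)
      then have "S \<le> r * ((K + 1) * e)" by simp
      then have "real S \<le> real (r * ((K + 1) * e))" by (rule of_nat_mono)
      then show ?thesis using e r by (simp add: field_simps)
    qed
    ultimately show ?thesis by (simp add: x_def)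
  qed
  obtain y :: "nat \<Rightarrow> nat \<Rightarrow> int" where y:
    "\<And>j k. j \<in> {1..r} \<Longrightarrow> k \<in> {..<e} \<Longrightarrow> \<lfloor>x j k\<rfloor> \<le> y j k"
    "\<And>j. j \<in> {1..r} \<Longrightarrow> (\<Sum>k<e. of_int (y j k)) = (\<Sum>k<e. x j k)"
    "\<And>k. k \<in> {..<e} \<Longrightarrow> (\<Sum>j=1..r. of_int (y j k)) = (\<Sum>j=1..r. x j k)"
    "(\<Sum>j=1..r. \<Sum>k<e. (of_int (y j k))\<^sup>2) \<le> (\<Sum>j=1..r. \<Sum>k<e. (x j k)\<^sup>2 + rounding_excess (x j k))"
    by (rule rounding_sum_of_squares[of "{1..r}" "{..<e}" x]) (auto simp: xrow xcol[simplified])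
  define z where "z j k = nat (y j k)" for j k
  have z: "real (z j k) = of_int (y j k)" if "j \<in> {1..r}" "k < e" for j k
  proof -
    have "0 \<le> y j k" using order_trans[OF xpos[OF that] y(1)[of j k]] that by simp
    then show ?thesis by (simp add: z_def)
  qed
  have zrow: "(\<Sum>k<e. z j k) = M j" if "j \<in> {1..r}" for j
  proof -
    have "real (\<Sum>k<e. z j k) = real (M j)" using y(2)[OF that] z[OF that] xrow by simp
    then show ?thesis by (simp only: of_nat_eq_iff)
  qed
  have zcol: "(\<Sum>j=1..r. z j k) = m k" if "k < e" for k
  proof -
    have "real (\<Sum>j=1..r. z j k) = (\<Sum>j=1..r. of_int (y j k))"
      unfolding of_nat_sum using that by (intro sum.cong refl z) auto
    then have "real (\<Sum>j=1..r. z j k) = real (m k)" using y(3)[of k] that xcol by simp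
    then show ?thesis by (simp only: of_nat_eq_iff)
  qed
  have "0 < bead_number e K s 1" using e by (simp add: bead_number_def K_def)
  then have le: "2 * total_level r e K s L \<le> (\<Sum>j=1..r. \<Sum>k<e. z j k * (z j k - 1))"
    using zrow zcol L by (intro reduced_total_level_le[OF e r _ fits]) (auto simp: M_def m_def n_def)
  have "2 * real (total_level r e K s L) \<le> (\<Sum>j=1..r. \<Sum>k<e. real (z j k * (z j k - 1)))"
    using of_nat_mono[OF le, where 'a = real] by (simp only: of_nat_sum of_nat_mult of_nat_numeral)
  also have "\<dots> = (\<Sum>j=1..r. (\<Sum>k<e. (real (z j k))\<^sup>2) - real (M j))"
    unfolding real_triangle sum_subtractf using zrow by (simp flip: of_nat_sum)
  also have "\<dots> = (\<Sum>j=1..r. \<Sum>k<e. (of_int (y j k))\<^sup>2) - real S"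
    by (simp add: sum_subtractf S_def z)
  also have "\<dots> \<le> (\<Sum>j=1..r. \<Sum>k<e. (x j k)\<^sup>2) + (\<Sum>j=1..r. \<Sum>k<e. rounding_excess (x j k)) - real S"
    using y(4) by (simp add: sum.distrib)
  finally have lev: "2 * real (total_level r e K s L) \<le>
    (\<Sum>j=1..r. \<Sum>k<e. (x j k)\<^sup>2) + (\<Sum>j=1..r. \<Sum>k<e. rounding_excess (x j k)) - real S" .
  have vac: "(\<Sum>j=1..r. \<Sum>k<e. real (v j k) * (real (v j k) - 1)) = (\<Sum>j=1..r. \<Sum>k<e. (real (v j k))\<^sup>2) - real S"
  proof -
    have "(\<Sum>j=1..r. \<Sum>k<e. real (v j k) * (real (v j k) - 1)) = (\<Sum>j=1..r. (\<Sum>k<e. (real (v j k))\<^sup>2) - (\<Sum>k<e. real (v j k)))"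
      by (simp add: sum_subtractf[symmetric] power2_eq_square algebra_simps)
    also have "\<dots> = (\<Sum>j=1..r. \<Sum>k<e. (real (v j k))\<^sup>2) - real S"
      using vrow by (simp add: sum_subtractf S_def flip: of_nat_sum)
    finally show ?thesis .
  qed
  have ne: "{1..r} \<noteq> {}" "{..<e} \<noteq> {}" using e r by auto
  define V where "V = (\<Sum>k<e. (real (\<Sum>j=1..r. v j k))\<^sup>2)"
  define N where "N = (\<Sum>k<e. (real (m k))\<^sup>2)"
  define R where "R = (\<Sum>j=1..r. (real (M j))\<^sup>2) / real e - (real S)\<^sup>2 / (real r * real e)"
  have sqx: "(\<Sum>j=1..r. \<Sum>k<e. (x j k)\<^sup>2) = N / real r + R"
    using interaction_identity[of "{1..r}" "{..<e}" x "\<lambda>j. real (M j)" "\<lambda>k. real (m k)", OF _ _ ne] xrow xcol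
    by (simp add: x_def S_def N_def R_def)
  have sqv: "N / real r + R + (V - N) / real r \<le> (\<Sum>j=1..r. \<Sum>k<e. (real (v j k))\<^sup>2)"
  proof -
    have "0 \<le> (\<Sum>j\<in>{1..r}. \<Sum>k\<in>{..<e}. (real (v j k) - (real (\<Sum>j=1..r. v j k) / real (card {1..r}) +
        real (M j) / real (card {..<e}) - (\<Sum>j\<in>{1..r}. real (M j)) / real (card {1..r} * card {..<e})))\<^sup>2)"
      by (intro sum_nonneg) simp
    also have "\<dots> = (\<Sum>j\<in>{1..r}. \<Sum>k\<in>{..<e}. (real (v j k))\<^sup>2) - ((\<Sum>k\<in>{..<e}. (real (\<Sum>j=1..r. v j k))\<^sup>2) / real (card {1..r})
       + (\<Sum>j\<in>{1..r}. (real (M j))\<^sup>2) / real (card {..<e})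
      - (\<Sum>j\<in>{1..r}. real (M j))\<^sup>2 / real (card {1..r} * card {..<e}))"
      using vrow by (intro interaction_identity ne) (auto simp flip: of_nat_sum)
    also have "\<dots> = (\<Sum>j=1..r. \<Sum>k<e. (real (v j k))\<^sup>2) - (V / real r + R)"
      by (simp add: V_def R_def S_def)
    finally show ?thesis by (simp add: diff_divide_distrib)
  qed
  define B where "B = (\<Sum>j=1..r. \<Sum>k<e. real (v j k) * (real (v j k) - 1))"
  have "weight r e s L = real r * (real (total_level r e K s L) - 1 / 2 * B) - 1 / 2 * (N - V)"
    by (simp only: weight_bead_matrix[OF e fits] B_def N_def V_def m_def n_def v_def)
  also have "\<dots> = real r / 2 * (2 * real (total_level r e K s L) - B) - (N - V) / 2"
    by (simp add: field_simps)
  also have "\<dots> \<le> real r / 2 * ((N / real r + R + (\<Sum>j=1..r. \<Sum>k<e. rounding_excess (x j k)) - real S)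
      - (N / real r + R + (V - N) / real r - real S)) - (N - V) / 2"
    using lev sqx sqv unfolding B_def vac by (intro diff_right_mono mult_left_mono diff_mono) auto
  also have "\<dots> = real r / 2 * (\<Sum>j=1..r. \<Sum>k<e. rounding_excess (x j k))"
    using r by (simp add: field_simps)
  also have "\<dots> \<le> real r / 2 * (\<Sum>j=1..r. of_int \<lfloor>(real e)\<^sup>2 / 4\<rfloor> / real e)"
    using sum_rounding_excess_le[OF e] xrow by (intro mult_left_mono sum_mono) auto
  also have "\<dots> = (real r)\<^sup>2 / (2 * real e) * of_int \<lfloor>(real e)\<^sup>2 / 4\<rfloor>"
    by (simp add: power2_eq_square)
  finally show ?thesis .
qed

section \<open>Reduced multicores of constant charge\<close>

text \<open>
  For a constant charge all entries of the empty matrix lie in \<open>{K, K + 1}\<close>, and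
  \<open>(n - K) (n - K - 1) \<ge> 0\<close> for every integer \<open>n\<close> with equality on \<open>{K, K + 1}\<close>. Hence no
  multipartition of this charge has a smaller total level than the empty one, and what remains of the
  weight formula is \<open>b\<close>, an expression in the differences of the content that does not depend on \<open>K\<close>.
\<close>

lemma constant_charge_weight:
  fixes \<tau> :: nat
  assumes e: "e > 0" and L: "fits r e K s L" and s: "\<And>j. j \<in> {1..r} \<Longrightarrow> s j mod int e = int \<tau>"
  defines "d \<equiv> \<lambda>k. real_of_int (content r e s L (int k) - content r e s L (int (Suc k)))"
  defines "b \<equiv> - 1 / 2 * (\<Sum>k<e. (d k)\<^sup>2 + 2 * real r * d k * of_bool (k < \<tau>))"
  shows "b \<le> weight r e s L"
    and "K = 0 \<Longrightarrow> total_level r e K s L = 0 \<Longrightarrow> weight r e s L = b"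
proof -
  define m where "m k = (\<Sum>j=1..r. bead_matrix e K s L j k)" for k
  define u :: "nat \<Rightarrow> real" where "u k = of_bool (k < \<tau>)" for k
  have vac: "empty_matrix e K s j k = K + of_bool (k < \<tau>)" if "j \<in> {1..r}" for j k
    using s[OF that] by (simp add: empty_matrix_def)
  have vcol: "(\<Sum>j=1..r. empty_matrix e K s j k) = r * (K + of_bool (k < \<tau>))" for k
    using vac by simp
  have d: "d k = real (m k) - real r * (real K + u k)" if "k < e" for k
  proof -
    have "content r e s L (int k) - content r e s L (int (Suc k)) = int (m k) - int (r * (K + of_bool (k < \<tau>)))"
      using content_bead_matrix[OF e L, of k] content_bead_matrix[OF e L, of "Suc k"] that
      by (simp add: m_def vcol[symmetric] del: of_nat_Suc)
    then show ?thesis unfolding d_def u_def by (simp del: of_nat_Suc)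
  qed
  have mrow: "(\<Sum>k<e. real (m k)) = (\<Sum>k<e. real r * (real K + u k))"
  proof -
    have "(\<Sum>k<e. m k) = (\<Sum>j=1..r. \<Sum>k<e. bead_matrix e K s L j k)"
      unfolding m_def by (rule sum.swap)
    also have "\<dots> = (\<Sum>j=1..r. \<Sum>k<e. empty_matrix e K s j k)"
      using bead_matrix_row_sum[OF e L] empty_matrix_row_sum[OF e] by simp
    also have "\<dots> = (\<Sum>k<e. r * (K + of_bool (k < \<tau>)))"
      by (subst sum.swap) (simp only: vcol)
    finally have "real (\<Sum>k<e. m k) = real (\<Sum>k<e. r * (K + of_bool (k < \<tau>)))" by simp
    then show ?thesis by (simp add: u_def)
  qed
  define X where "X = real (total_level r e K s L) - 1 / 2 * (\<Sum>j=1..r. \<Sum>k<e. (real K + u k) * (real K + u k - 1))"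
  have sq: "(\<Sum>k<e. (real (m k))\<^sup>2) - (\<Sum>k<e. (real r * (real K + u k))\<^sup>2)
      = (\<Sum>k<e. (d k)\<^sup>2 + 2 * real r * d k * u k)"
  proof -
    have "(\<Sum>k<e. d k) = 0" using mrow d by (simp add: sum_subtractf)
    then have "(\<Sum>k<e. 2 * real r * real K * d k) = 0" by (simp add: sum_distrib_left[symmetric])
    moreover have "(\<Sum>k<e. (real (m k))\<^sup>2) - (\<Sum>k<e. (real r * (real K + u k))\<^sup>2)
      = (\<Sum>k<e. (d k)\<^sup>2 + 2 * real r * d k * u k) + (\<Sum>k<e. 2 * real r * real K * d k)"
      unfolding sum.distrib[symmetric] sum_subtractf[symmetric]
      by (intro sum.cong refl) (simp add: d power2_eq_square algebra_simps)
    ultimately show ?thesis by simp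
  qed
  have w: "weight r e s L = real r * X + b"
    using weight_bead_matrix[OF e L] sq by (simp add: X_def b_def u_def m_def vcol vac)
  have "(\<Sum>j=1..r. \<Sum>k<e. (real K + u k) * (real K + u k - 1)) \<le> 2 * real (total_level r e K s L)"
  proof -
    let ?n = "bead_matrix e K s L"
    have le: "(\<Sum>j=1..r. \<Sum>k<e. ?n j k * (?n j k - 1)) \<le> 2 * total_level r e K s L"
      unfolding total_level_def sum_distrib_left bead_matrix_def
      by (intro sum_mono triangle_le_level e finite_beads)
    have 1: "(\<Sum>j=1..r. \<Sum>k<e. real (?n j k * (?n j k - 1))) \<le> 2 * real (total_level r e K s L)"
      using of_nat_mono[OF le, where 'a = real] by (simp only: of_nat_sum of_nat_mult of_nat_numeral)
    have "2 * real K * real n - real K * (real K + 1) \<le> real (n * (n - 1))" for n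
    proof -
      have "0 \<le> (real n - real K) * (real n - real K - 1)"
        by (cases "n \<le> K") (auto intro: mult_nonneg_nonneg mult_nonpos_nonpos)
      then show ?thesis by (simp add: real_triangle power2_eq_square algebra_simps)
    qed
    then have "(\<Sum>j=1..r. \<Sum>k<e. 2 * real K * real (?n j k) - real K * (real K + 1)) \<le>
        (\<Sum>j=1..r. \<Sum>k<e. real (?n j k * (?n j k - 1)))" by (intro sum_mono)
    moreover have "(\<Sum>j=1..r. \<Sum>k<e. 2 * real K * real (?n j k) - real K * (real K + 1))
       = (\<Sum>j=1..r. \<Sum>k<e. (real K + u k) * (real K + u k - 1))"
    proof -
      have "(\<Sum>j=1..r. \<Sum>k<e. 2 * real K * real (?n j k) - real K * (real K + 1)) =
        (\<Sum>k<e. 2 * real K * real (m k) - real r * (real K * (real K + 1)))"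
        by (subst sum.swap) (simp add: sum_subtractf m_def sum_distrib_left)
      also have "\<dots> = (\<Sum>k<e. 2 * real K * (real r * (real K + u k)) - real r * (real K * (real K + 1)))"
        unfolding sum_subtractf sum_distrib_left[symmetric] mrow[unfolded sum_distrib_left[symmetric]] ..
      also have "\<dots> = (\<Sum>k<e. real r * ((real K + u k) * (real K + u k - 1)))"
        by (intro sum.cong refl) (simp add: u_def algebra_simps)
      also have "\<dots> = (\<Sum>j=1..r. \<Sum>k<e. (real K + u k) * (real K + u k - 1))"
        by (simp add: sum_distrib_left)
      finally show ?thesis .
    qed
    ultimately show ?thesis using 1 by linarith
  qed
  then have "0 \<le> real r * X" by (simp add: X_def)
  then show "b \<le> weight r e s L" using w by simp
  show "weight r e s L = b" if "K = 0" "total_level r e K s L = 0"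
  proof -
    have "(real K + u k) * (real K + u k - 1) = 0" for k using that by (simp add: u_def)
    then have "(\<Sum>j=1..r. \<Sum>k<e. (real K + u k) * (real K + u k - 1)) = 0"
      by (intro sum.neutral ballI)
    then have "X = 0" using that(2) unfolding X_def by linarith
    then show ?thesis using w by simp
  qed
qed

text \<open>
  Subtracting \<open>\<delta>\<close> from the content keeps its differences, hence the lower bound for the weight, but
  lowers the weight by \<open>r\<close>. Since \<open>L\<close> attains the bound, no multipartition has the smaller content.
\<close>

lemma constant_charge_reduced:
  assumes e: "e > 0" and r: "r > 0" and L: "fits r e 0 s L" "total_level r e 0 s L = 0"
    and s: "\<And>j. j \<in> {1..r} \<Longrightarrow> s j mod int e = int \<tau>"
  shows "L \<in> reduced_multicores r e s"
proof (rule ccontr)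
  assume "\<not> ?thesis"
  then obtain L' where L': "L' \<in> multipartitions r" "content r e s L' = content r e s L - delta"
    using L(1) by (auto simp: reduced_multicores_def fits_def contents_def)
  have eq: "content r e s L' i = content r e s L i - 1" for i
    using L'(2) by (simp add: delta_def)
  define K where "K = (\<Sum>j=1..r. length (L' j))"
  have "fits r e K s L'"
    unfolding fits_def
  proof (intro conjI ballI L')
    fix j assume "j \<in> {1..r}"
    then have "length (L' j) \<le> K" unfolding K_def by (intro member_le_sum) auto
    also have "K * 1 \<le> K * e" using e by (intro mult_le_mono2) simp
    finally show "length (L' j) \<le> bead_number e K s j" by (simp add: bead_number_def)
  qed
  from constant_charge_weight(1)[OF e this s] have "weight r e s L \<le> weight r e s L'"
    using constant_charge_weight(2)[OF e L(1) s _ L(2)] by (simp add: eq del: of_nat_Suc)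
  moreover have "weight r e s L' = weight r e s L - real r"
    by (simp add: weight_content eq sum_subtractf del: of_nat_Suc)
  ultimately show False using r by simp
qed

text \<open>
  Cut \<open>{..<r * \<tau>}\<close> into \<open>r\<close> intervals of length \<open>\<tau>\<close> and let row \<open>j\<close> be the indicator of the residues
  in the \<open>j\<close>th interval. Its entries are at most 1 because \<open>\<tau> < e\<close>, and consecutive intervals continue
  around the circle of residues, so the column sums are as equal as possible.
\<close>

lemma balanced_reduced_multicore:
  assumes e: "e \<ge> 2" and r: "r > 0" and \<tau>: "0 < \<tau>" "\<tau> < e"
  defines "s \<equiv> restrict (\<lambda>_. int \<tau>) {1..r}"
  defines "q \<equiv> r * \<tau> div e" and "f \<equiv> r * \<tau> mod e"
  obtains L where "s \<in> multicharges r" "L \<in> reduced_multicores r e s"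
    "weight r e s L = ((real r)\<^sup>2 * real \<tau> - (real e * (real q)\<^sup>2 + 2 * real q * real f + real f)) / 2"
proof -
  have e0: "e > 0" using e by simp
  define y where "y j k = runner e {(j - 1) * \<tau>..<j * \<tau>} k" for j k
  have s: "s j mod int e = int \<tau>" if "j \<in> {1..r}" for j using that \<tau> by (simp add: s_def)
  have bn: "bead_number e 0 s j = \<tau>" if "j \<in> {1..r}" for j using s[OF that] by (simp add: bead_number_def)
  have row: "(\<Sum>k<e. y j k) = bead_number e 0 s j" if j: "j \<in> {1..r}" for j
  proof -
    have "j * \<tau> - (j - 1) * \<tau> = \<tau>" using j by (cases j) auto
    then show ?thesis using sum_runner[OF e0] bn[OF j] by (simp add: y_def)
  qed
  have y1: "y j k \<le> 1" for j k
  proof -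
    have "x = x'" if "x \<in> {(j - 1) * \<tau>..<j * \<tau>}" "x' \<in> {(j - 1) * \<tau>..<j * \<tau>}" "x mod e = x' mod e" "x \<le> x'" for x x'
    proof -
      have "j * \<tau> \<le> (j - 1) * \<tau> + \<tau>" by (cases j) auto
      then have "x' - x < e" using that \<tau> by auto
      moreover have "e dvd x' - x" by (rule iffD1[OF mod_eq_dvd_iff_nat[OF that(4)] that(3)[symmetric]])
      ultimately have "x' - x = 0" using nat_dvd_not_less by blast
      then show ?thesis using that(4) by simp
    qed
    note aux = this
    have "x = x'" if "x \<in> {(j - 1) * \<tau>..<j * \<tau>}" "x' \<in> {(j - 1) * \<tau>..<j * \<tau>}" "x mod e = x' mod e" for x x'
    proof (cases x x' rule: le_cases)
      case le
      then show ?thesis using aux that by blast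
    next
      case ge
      then show ?thesis using aux[OF that(2,1) that(3)[symmetric]] by simp
    qed
    then show ?thesis
      unfolding y_def runner_def by (subst One_nat_def, subst card_le_Suc0_iff_eq) auto
  qed
  have col: "(\<Sum>j=1..r. y j k) = q + of_bool (k < f)" if k: "k < e" for k
  proof -
    have "(\<Sum>j=1..n. y j k) = runner e {..<n * \<tau>} k" for n
    proof (induction n)
      case 0
      then show ?case by (simp add: runner_def)
    next
      case (Suc n)
      have split: "{x \<in> {..<Suc n * \<tau>}. x mod e = k} = {x \<in> {..<n * \<tau>}. x mod e = k} \<union> {x \<in> {n * \<tau>..<Suc n * \<tau>}. x mod e = k}"
        by auto
      have "runner e {..<Suc n * \<tau>} k = runner e {..<n * \<tau>} k + runner e {n * \<tau>..<Suc n * \<tau>} k"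
        unfolding runner_def split by (rule card_Un_disjoint) auto
      then show ?case using Suc by (simp add: y_def)
    qed
    moreover have "r * \<tau> = q * e + f" by (simp add: q_def f_def)
    moreover have "f \<le> e" using e0 by (simp add: f_def less_imp_le)
    ultimately show ?thesis using runner_lessThan[OF e0 _ k, of f q] by simp
  qed
  have pos: "0 < bead_number e 0 s 1" using bn[of 1] r \<tau> by simp
  obtain L where L: "fits r e 0 s L" "\<And>j k. j \<in> {1..r} \<Longrightarrow> k < e \<Longrightarrow> bead_matrix e 0 s L j k = y j k"
    "2 * total_level r e 0 s L = (\<Sum>j=1..r. \<Sum>k<e. y j k * (y j k - 1)) + 2 * 0"
    using ex_bead_matrix[where y = y and w = 0, OF e0 r pos row] by blast
  have "y j k * (y j k - 1) = 0" for j k using y1[of j k] by simp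
  then have "(\<Sum>j=1..r. \<Sum>k<e. y j k * (y j k - 1)) = 0" by (intro sum.neutral ballI)
  then have lev: "total_level r e 0 s L = 0" using L(3) by linarith
  have vac: "empty_matrix e 0 s j k = of_bool (k < \<tau>)" if "j \<in> {1..r}" for j k
    using s[OF that] by (simp add: empty_matrix_def)
  have ind: "(\<Sum>k<e. c * of_bool (k < t)) = c * real t" if "t \<le> e" for c :: real and t
  proof -
    have "(\<Sum>k<e. c * of_bool (k < t)) = (\<Sum>k<t. c)" using that by (intro sum.mono_neutral_cong_right) auto
    then show ?thesis by simp
  qed
  have "(\<Sum>k<e. (real (\<Sum>j=1..r. empty_matrix e 0 s j k))\<^sup>2) = (\<Sum>k<e. (real r)\<^sup>2 * of_bool (k < \<tau>))"
    using vac by (intro sum.cong refl) auto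
  then have v: "(\<Sum>k<e. (real (\<Sum>j=1..r. empty_matrix e 0 s j k))\<^sup>2) = (real r)\<^sup>2 * real \<tau>"
    using ind[OF less_imp_le[OF \<tau>(2)], of "(real r)\<^sup>2"] by (rule trans)
  have "(\<Sum>k<e. (real (\<Sum>j=1..r. bead_matrix e 0 s L j k))\<^sup>2) = (\<Sum>k<e. (real q)\<^sup>2 + (2 * real q + 1) * of_bool (k < f))"
    using L(2) col by (intro sum.cong refl) (simp add: power2_eq_square algebra_simps)
  also have "\<dots> = real e * (real q)\<^sup>2 + (2 * real q + 1) * real f"
    using e0 by (subst sum.distrib, subst ind) (auto simp: f_def less_imp_le)
  finally have m: "(\<Sum>k<e. (real (\<Sum>j=1..r. bead_matrix e 0 s L j k))\<^sup>2) = real e * (real q)\<^sup>2 + (2 * real q + 1) * real f" .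
  have "(\<Sum>j=1..r. \<Sum>k<e. real (empty_matrix e 0 s j k) * (real (empty_matrix e 0 s j k) - 1)) = 0"
    using vac by (intro sum.neutral ballI) auto
  then have "weight r e s L = ((real r)\<^sup>2 * real \<tau> - (real e * (real q)\<^sup>2 + 2 * real q * real f + real f)) / 2"
    unfolding weight_bead_matrix[OF e0 L(1)] v m lev by (simp add: field_simps)
  moreover have "L \<in> reduced_multicores r e s" by (rule constant_charge_reduced[OF e0 r L(1) lev s])
  moreover have "s \<in> multicharges r" by (simp add: s_def multicharges_def)
  ultimately show thesis using that by blast
qed

lemma floor_quarter_square: "\<lfloor>(real e)\<^sup>2 / 4\<rfloor> = int (e div 2 * (e - e div 2))"
proof (cases "even e")
  case True
  then obtain t where "e = 2 * t" by blast
  then show ?thesis by (simp add: power2_eq_square floor_eq_iff)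
next
  case False
  then obtain t where "e = 2 * t + 1" by (elim oddE)
  then show ?thesis by (simp add: power2_eq_square floor_eq_iff algebra_simps)
qed

text \<open>
  For \<open>e \<le> 6\<close> this follows from \<open>f (e - f) \<le> e\<^sup>2 / 4\<close>. If \<open>e\<close> is even and \<open>r\<close> is 2 or 4, then \<open>f = 0\<close>.
  If \<open>e\<close> is odd, \<open>2 (e div 2) = e - 1\<close> makes \<open>f\<close> equal to \<open>e - 1\<close> for \<open>r = 2\<close> and to \<open>e - 2\<close> for \<open>r = 4\<close>.
\<close>

lemma remainder_gap:
  fixes e r :: nat
  assumes "e \<ge> 2" and "r \<in> {2, 4} \<or> e \<in> {2, 3, 4, 5, 6}"
  defines "f \<equiv> r * (e div 2) mod e"
  shows "f * (e - f) < 2 * e"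
proof (cases "e \<in> {2, 3, 4, 5, 6}")
  case True
  have "f < e" using assms by simp
  then have "f \<in> {0, 1, 2, 3, 4, 5}" using True by auto
  then show ?thesis using True \<open>f < e\<close> by auto
next
  case False
  then consider "r = 2" | "r = 4" using assms by auto
  then show ?thesis
  proof cases
    case 1
    have "f = 0 \<or> f = e - 1"
    proof (cases "even e")
      case True
      then show ?thesis using 1 by (simp add: f_def)
    next
      case False
      then have "2 * (e div 2) = e - 1" by (simp add: odd_two_times_div_two_nat)
      then show ?thesis using 1 assms(1) by (simp add: f_def)
    qed
    then show ?thesis using assms(1) by auto
  next
    case 2
    have "f = 0 \<or> f = e - 2"
    proof (cases "even e")
      case True
      then obtain t where "e = 2 * t" by blast
      then show ?thesis using 2 by (auto simp: f_def)
    next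
      case odd: False
      then have "r * (e div 2) = 2 * (e - 1)" using 2 by (simp add: odd_two_times_div_two_nat[symmetric])
      also have "\<dots> = e + (e - 2)" using assms(1) by simp
      finally have "f = (e - 2) mod e" unfolding f_def by (simp only: mod_add_self1)
      then show ?thesis using assms(1) by simp
    qed
    then show ?thesis using assms(1) by auto
  qed
qed

theorem proposition3p47:
  fixes r e :: nat
  assumes "e \<ge> 2" and "r \<ge> 2"
    and "r \<in> {2, 4} \<or> e \<in> {2, 3, 4, 5, 6}"
  shows "max_weight r e = ereal (real_of_int (max_weight' r e))"
proof -
  define \<tau> where "\<tau> = e div 2"
  define q where "q = r * \<tau> div e"
  define f where "f = r * \<tau> mod e"
  define N where "N = (real r)\<^sup>2 / (2 * real e) * of_int \<lfloor>(real e)\<^sup>2 / 4\<rfloor>"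
  have e: "e > 0" and r: "r > 0" and \<tau>: "0 < \<tau>" "\<tau> < e" using assms by (auto simp: \<tau>_def)
  obtain s L where sL: "s \<in> multicharges r" "L \<in> reduced_multicores r e s"
    "weight r e s L = ((real r)\<^sup>2 * real \<tau> - (real e * (real q)\<^sup>2 + 2 * real q * real f + real f)) / 2"
    using balanced_reduced_multicore[OF assms(1) r \<tau>] unfolding q_def f_def by metis
  have f: "f < e" using e by (simp add: f_def)
  \<comment> \<open>the shortfall caused by column sums that have to be integers\<close>
  have "N - weight r e s L = real (f * (e - f)) / (2 * real e)"
  proof -
    have "real r * real \<tau> = real e * real q + real f"
      unfolding q_def f_def by (metis mult_div_mod_eq of_nat_add of_nat_mult)
    then have "(real r * real \<tau>)\<^sup>2 = (real e * real q + real f)\<^sup>2" by simp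
    then have "(real r)\<^sup>2 * (real \<tau>)\<^sup>2 = (real e)\<^sup>2 * (real q)\<^sup>2 + 2 * real e * real q * real f + (real f)\<^sup>2"
      by (simp add: power2_eq_square algebra_simps)
    moreover have "N = (real r)\<^sup>2 / (2 * real e) * (real \<tau> * (real e - real \<tau>))"
      unfolding N_def floor_quarter_square using \<tau> by (simp add: \<tau>_def[symmetric] of_nat_diff)
    ultimately show ?thesis
      using e f by (simp add: sL(3) of_nat_diff field_simps power2_eq_square)
  qed
  moreover have "f * (e - f) < 2 * e"
    using remainder_gap[OF assms(1,3)] by (simp add: f_def \<tau>_def)
  then have "real (f * (e - f)) < 2 * real e" by (metis of_nat_less_iff of_nat_mult of_nat_numeral)
  then have "0 \<le> real (f * (e - f)) / (2 * real e)" "real (f * (e - f)) / (2 * real e) < 1"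
    using e by (simp_all add: divide_less_eq)
  ultimately have near: "weight r e s L \<le> N" "N < weight r e s L + 1" by linarith+
  obtain w where w: "weight r e s L = real_of_int w"
    using weight_Ints[OF e, of r s L] by (elim Ints_cases)
  have N: "max_weight' r e = \<lfloor>N\<rfloor>" by (simp add: max_weight'_def N_def)
  then have "max_weight' r e = w" using near unfolding w by (simp add: floor_eq_iff)
  then have attained: "weight r e s L = real_of_int (max_weight' r e)" using w by simp
  have upper: "weight r e t P \<le> real_of_int (max_weight' r e)" if "P \<in> reduced_multicores r e t" for t P
  proof -
    obtain a where a: "weight r e t P = real_of_int a"
      using weight_Ints[OF e, of r t P] by (elim Ints_cases)
    then show ?thesis using reduced_weight_le[OF e r that] unfolding N by (simp add: N_def le_floor_iff)
  qed
  show ?thesis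
    unfolding max_weight_def
  proof (rule Sup_eqI)
    show "x \<le> ereal (real_of_int (max_weight' r e))"
      if "x \<in> {ereal (weight r e s L) |s L. s \<in> multicharges r \<and> L \<in> reduced_multicores r e s}" for x
      using that upper by auto
  next
    show "ereal (real_of_int (max_weight' r e)) \<le> b"
      if "\<And>x. x \<in> {ereal (weight r e s L) |s L. s \<in> multicharges r \<and> L \<in> reduced_multicores r e s} \<Longrightarrow> x \<le> b" for b
      using that sL(1,2) unfolding attained[symmetric] by blast
  qed
qed

end
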